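(* Let $n\ge 2$. Any distinguished representative $w$ of $W(\tilde A_n)/W(A_n)$ has a unique reduced expression of the form $$\mathcal B(j_1,i_1)\,\mathcal B(j_2,i_2)\cdots \mathcal B(j_m,i_m),$$ where $m=L(w)$ is the affine length of $w$ and $(j_s,i_s)_{1\le s\le m}$ is a family of integers satisfying the following conditions (the pairwise inequalities): <br>(a) $1\le j_1\le n+1$ and $0\le i_1\le n-1$; for $2\le s\le m$, either $i_s=0$ and $j_s=1$, or $1\le i_s\le n-1$ and $1\le j_s\le n$; <br>(b) the sequence $(j_s)$ is non-increasing and the sequence $(i_s)$ is non-decreasing; <br>(c) for $2\le s\le m$: if $j_{s-1}>i_{s-1}+1$ then $j_s<j_{s-1}$; if $j_s>i_s+1$ then $i_s>i_{s-1}$. <br>Conversely, for any family $(j_s,i_s)_{1\le s\le m}$ of integers satisfying (a), (b), (c), the expression $\mathcal B(j_1,i_1)\mathcal B(j_2,i_2)\cdots\mathcal B(j_m,i_m)$ is a reduced expression of a distinguished representative of $W(\tilde A_n)/W(A_n)$ of affine length $m$.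
   Context: For $n\ge2$, $W(\tilde A_n)$ is the Coxeter group with generating set $S_n=\{\sigma_1,\dots,\sigma_n,a_{n+1}\}$ whose Coxeter graph is the cycle $\sigma_1-\sigma_2-\cdots-\sigma_n-a_{n+1}-\sigma_1$ (all edges of label 3). $W(A_n)$ is the parabolic subgroup generated by $\sigma_1,\dots,\sigma_n$. $l$ denotes Coxeter length. A distinguished representative of $W(\tilde A_n)/W(A_n)$ is the unique element of minimal length in a coset $wW(A_n)$. The affine length $L(w)$ of $w\in W(\tilde A_n)$ is the minimal number of occurrences of $a_{n+1}$ among all expressions of $w$ as words in $S_n$ (equivalently among all reduced expressions). Notation (words in the generators): $\lfloor i,j\rfloor=\sigma_i\sigma_{i+1}\cdots\sigma_j$ for $1\le i\le j\le n$ and $\lfloor n+1,n\rfloor=1$; $\lceil i,j\rceil=\sigma_i\sigma_{i-1}\cdots\sigma_j$ for $n\ge i\ge j\ge1$ and $\lceil 0,1\rceil=1$. For $1\le r\le n+1$ and $0\le i\le n-1$, $h(r,i)=\lfloor r,n\rfloor\lceil i,1\rceil$, and the affine brick is $\mathcal B(r,i)=h(r,i)\,a_{n+1}$. For $m=0$ the family is empty and the product is the identity. *)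

theory Defs
  imports "HOL-Algebra.Algebra"
begin

section \<open>Coxeter groups by presentation\<close>

text \<open>
  A Coxeter matrix is a function \<open>m\<close> on a set \<open>S\<close> of generators, where the value \<open>0\<close> stands for
  infinity (no relation). Since \<open>m s s = 1\<close> makes every generator an involution, the group
  \<open>\<langle>S | (st)^m(s,t) = 1\<rangle>\<close> coincides with the monoid given by the same presentation, so the group
  is the set of positive words over \<open>S\<close> modulo the congruence generated by the relations.
\<close>

inductive cox_eq :: "'s set \<Rightarrow> ('s \<Rightarrow> 's \<Rightarrow> nat) \<Rightarrow> 's list \<Rightarrow> 's list \<Rightarrow> bool"
  for S :: "'s set" and m :: "'s \<Rightarrow> 's \<Rightarrow> nat" where
  relator: "u \<in> lists S \<Longrightarrow> v \<in> lists S \<Longrightarrow> s \<in> S \<Longrightarrow> t \<in> S \<Longrightarrow>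
    cox_eq S m (u @ concat (replicate (m s t) [s, t]) @ v) (u @ v)"
| refl: "u \<in> lists S \<Longrightarrow> cox_eq S m u u"
| sym: "cox_eq S m u v \<Longrightarrow> cox_eq S m v u"
| trans: "cox_eq S m u v \<Longrightarrow> cox_eq S m v w \<Longrightarrow> cox_eq S m u w"

definition word_class :: "'s set \<Rightarrow> ('s \<Rightarrow> 's \<Rightarrow> nat) \<Rightarrow> 's list \<Rightarrow> 's list set" where
  "word_class S m u = {v. cox_eq S m u v}"

definition coxeter_group :: "'s set \<Rightarrow> ('s \<Rightarrow> 's \<Rightarrow> nat) \<Rightarrow> 's list set monoid" where
  "coxeter_group S m =
    \<lparr>carrier = word_class S m ` lists S,
     monoid.mult = (\<lambda>A B. {w. \<exists>u\<in>A. \<exists>v\<in>B. cox_eq S m (u @ v) w}),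
     one = word_class S m []\<rparr>"

lemma cox_eq_lists:
  assumes "cox_eq S m u v"
  shows "u \<in> lists S \<and> v \<in> lists S"
  using assms
proof induction
  case (relator u v s t)
  then have "set (concat (replicate (m s t) [s, t])) \<subseteq> S" by auto
  with relator show ?case by auto
qed auto

lemma cox_eq_append_left:
  assumes "cox_eq S m u v" "x \<in> lists S"
  shows "cox_eq S m (x @ u) (x @ v)"
  using assms
proof induction
  case (relator u v s t)
  then show ?case using cox_eq.relator[of "x @ u" S v s t m] by simp
next
  case (refl u)
  then show ?case by (intro cox_eq.refl) auto
qed (blast intro: cox_eq.sym cox_eq.trans)+

lemma cox_eq_append_right:
  assumes "cox_eq S m u v" "x \<in> lists S"
  shows "cox_eq S m (u @ x) (v @ x)"
  using assms
proof induction
  case (relator u v s t)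
  then show ?case using cox_eq.relator[of u S "v @ x" s t m] by simp
next
  case (refl u)
  then show ?case by (intro cox_eq.refl) auto
qed (blast intro: cox_eq.sym cox_eq.trans)+

lemma cox_eq_append:
  assumes "cox_eq S m u u'" "cox_eq S m v v'"
  shows "cox_eq S m (u @ v) (u' @ v')"
  using cox_eq.trans[OF cox_eq_append_right[OF assms(1)] cox_eq_append_left[OF assms(2)]]
    cox_eq_lists[OF assms(1)] cox_eq_lists[OF assms(2)] by blast

lemma word_class_eq_iff:
  assumes "u \<in> lists S"
  shows "word_class S m u = word_class S m v \<longleftrightarrow> cox_eq S m u v"
proof
  assume "word_class S m u = word_class S m v"
  moreover have "u \<in> word_class S m u"
    using assms by (simp add: word_class_def cox_eq.refl)
  ultimately have "u \<in> word_class S m v" by simp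
  then show "cox_eq S m u v" by (auto simp: word_class_def intro: cox_eq.sym)
next
  assume "cox_eq S m u v"
  then show "word_class S m u = word_class S m v"
    unfolding word_class_def by (blast intro: cox_eq.sym cox_eq.trans)
qed

lemma word_class_mult:
  assumes "u \<in> lists S" "v \<in> lists S"
  shows "word_class S m u \<otimes>\<^bsub>coxeter_group S m\<^esub> word_class S m v = word_class S m (u @ v)"
proof -
  have "cox_eq S m (u @ v) w \<longleftrightarrow>
      (\<exists>u'. cox_eq S m u u' \<and> (\<exists>v'. cox_eq S m v v' \<and> cox_eq S m (u' @ v') w))" for w
    using cox_eq.refl[OF assms(1), of m] cox_eq.refl[OF assms(2), of m]
    by (blast intro: cox_eq.trans[OF cox_eq_append])
  then show ?thesis by (auto simp: coxeter_group_def word_class_def)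
qed

lemma cox_eq_rev:
  assumes "\<And>s. s \<in> S \<Longrightarrow> m s s = 1" "u \<in> lists S"
  shows "cox_eq S m (rev u @ u) []"
  using assms(2)
proof (induction u)
  case (Cons s u)
  then have "s \<in> S" "u \<in> lists S" "rev u \<in> lists S" by auto
  then have "cox_eq S m (rev u @ [s, s] @ u) (rev u @ u)"
    using cox_eq.relator[of "rev u" S u s s m] assms(1)[of s] by simp
  from cox_eq.trans[OF this Cons.IH] show ?case by simp
qed (simp add: cox_eq.refl)

lemma group_coxeter_group:
  assumes "\<And>s. s \<in> S \<Longrightarrow> m s s = 1"
  shows "group (coxeter_group S m)"
proof (rule groupI)
  let ?G = "coxeter_group S m"
  have carr: "carrier ?G = word_class S m ` lists S" and one: "\<one>\<^bsub>?G\<^esub> = word_class S m []"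
    by (simp_all add: coxeter_group_def)
  show "\<one>\<^bsub>?G\<^esub> \<in> carrier ?G" by (auto simp: carr one)
  fix x assume "x \<in> carrier ?G"
  then obtain u where u: "u \<in> lists S" "x = word_class S m u" by (auto simp: carr)
  show "\<one>\<^bsub>?G\<^esub> \<otimes>\<^bsub>?G\<^esub> x = x" using u by (simp add: one word_class_mult)
  have "rev u \<in> lists S" using u by auto
  moreover have "word_class S m (rev u @ u) = word_class S m []"
    using cox_eq_rev[where S=S and m=m, OF assms u(1)] u(1) by (subst word_class_eq_iff) auto
  ultimately show "\<exists>y\<in>carrier ?G. y \<otimes>\<^bsub>?G\<^esub> x = \<one>\<^bsub>?G\<^esub>"
    using u by (auto simp: carr one word_class_mult intro: bexI[of _ "word_class S m (rev u)"])
  fix y assume "y \<in> carrier ?G"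
  then obtain v where v: "v \<in> lists S" "y = word_class S m v" by (auto simp: carr)
  show "x \<otimes>\<^bsub>?G\<^esub> y \<in> carrier ?G" using u v by (auto simp: carr word_class_mult)
  fix z assume "z \<in> carrier ?G"
  then obtain w where w: "w \<in> lists S" "z = word_class S m w" by (auto simp: carr)
  show "x \<otimes>\<^bsub>?G\<^esub> y \<otimes>\<^bsub>?G\<^esub> z = x \<otimes>\<^bsub>?G\<^esub> (y \<otimes>\<^bsub>?G\<^esub> z)"
    using u v w by (simp add: word_class_mult)
qed

section \<open>The affine Weyl group of type A tilde\<close>

text \<open>\<open>Sig i\<close> is the generator \<open>\<sigma>\<^sub>i\<close>, and \<open>Aff\<close> is the affine generator \<open>a\<^sub>n\<^sub>+\<^sub>1\<close>.\<close>

datatype gen = Sig nat | Aff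

definition gens :: "nat \<Rightarrow> gen set" where
  "gens n = insert Aff (Sig ` {1..n})"

text \<open>Edges of the cycle \<open>\<sigma>\<^sub>1 - \<sigma>\<^sub>2 - \<dots> - \<sigma>\<^sub>n - a\<^sub>n\<^sub>+\<^sub>1 - \<sigma>\<^sub>1\<close>.\<close>

fun adjacent :: "nat \<Rightarrow> gen \<Rightarrow> gen \<Rightarrow> bool" where
  "adjacent n (Sig i) (Sig j) \<longleftrightarrow> j = i + 1 \<or> i = j + 1"
| "adjacent n (Sig i) Aff \<longleftrightarrow> i = 1 \<or> i = n"
| "adjacent n Aff (Sig i) \<longleftrightarrow> i = 1 \<or> i = n"
| "adjacent n Aff Aff \<longleftrightarrow> False"

definition cox_matrix :: "nat \<Rightarrow> gen \<Rightarrow> gen \<Rightarrow> nat" where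
  "cox_matrix n s t = (if s = t then 1 else if adjacent n s t then 3 else 2)"

definition W_aff :: "nat \<Rightarrow> gen list set monoid" where
  "W_aff n = coxeter_group (gens n) (cox_matrix n)"

lemma group_W_aff: "group (W_aff n)"
  unfolding W_aff_def by (rule group_coxeter_group) (simp add: cox_matrix_def)

definition W_fin :: "nat \<Rightarrow> gen list set set" where
  "W_fin n = generate (W_aff n) ((\<lambda>i. word_class (gens n) (cox_matrix n) [Sig i]) ` {1..n})"

definition expression :: "nat \<Rightarrow> gen list \<Rightarrow> gen list set \<Rightarrow> bool" where
  "expression n u w \<longleftrightarrow> u \<in> lists (gens n) \<and> word_class (gens n) (cox_matrix n) u = w"

definition cox_length :: "nat \<Rightarrow> gen list set \<Rightarrow> nat" where
  "cox_length n w = (LEAST k. \<exists>u. expression n u w \<and> length u = k)"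

definition reduced_expression :: "nat \<Rightarrow> gen list \<Rightarrow> gen list set \<Rightarrow> bool" where
  "reduced_expression n u w \<longleftrightarrow> expression n u w \<and> length u = cox_length n w"

definition affine_length :: "nat \<Rightarrow> gen list set \<Rightarrow> nat" where
  "affine_length n w = (LEAST k. \<exists>u. expression n u w \<and> count_list u Aff = k)"

text \<open>The strict inequality says that \<open>w\<close> is the only element of minimal length in its coset.\<close>

definition distinguished_rep :: "nat \<Rightarrow> gen list set \<Rightarrow> bool" where
  "distinguished_rep n w \<longleftrightarrow> w \<in> carrier (W_aff n) \<and>
    (\<forall>v \<in> w <#\<^bsub>W_aff n\<^esub> W_fin n. v \<noteq> w \<longrightarrow> cox_length n w < cox_length n v)"

section \<open>Affine bricks\<close>

definition up_word :: "nat \<Rightarrow> nat \<Rightarrow> gen list" where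
  "up_word i j = map Sig [i..<j + 1]"

definition down_word :: "nat \<Rightarrow> nat \<Rightarrow> gen list" where
  "down_word i j = map Sig (rev [j..<i + 1])"

definition h_word :: "nat \<Rightarrow> nat \<Rightarrow> nat \<Rightarrow> gen list" where
  "h_word n r i = up_word r n @ down_word i 1"

definition brick :: "nat \<Rightarrow> nat \<Rightarrow> nat \<Rightarrow> gen list" where
  "brick n r i = h_word n r i @ [Aff]"

text \<open>
  A family \<open>(j\<^sub>s, i\<^sub>s)\<close> with \<open>1 \<le> s \<le> m\<close> is a list of \<open>m\<close> pairs; \<open>jj\<close> and \<open>ii\<close> restore the indexing
  from \<open>1\<close>. Natural numbers suffice since the first condition makes all entries nonnegative.
\<close>

definition brick_word :: "nat \<Rightarrow> (nat \<times> nat) list \<Rightarrow> gen list" where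
  "brick_word n ps = concat (map (\<lambda>(j, i). brick n j i) ps)"

definition jj :: "(nat \<times> nat) list \<Rightarrow> nat \<Rightarrow> nat" where
  "jj ps s = fst (ps ! (s - 1))"

definition ii :: "(nat \<times> nat) list \<Rightarrow> nat \<Rightarrow> nat" where
  "ii ps s = snd (ps ! (s - 1))"

definition cond_a :: "nat \<Rightarrow> (nat \<times> nat) list \<Rightarrow> bool" where
  "cond_a n ps \<longleftrightarrow>
    (1 \<le> length ps \<longrightarrow> 1 \<le> jj ps 1 \<and> jj ps 1 \<le> n + 1 \<and> 0 \<le> ii ps 1 \<and> ii ps 1 \<le> n - 1) \<and>
    (\<forall>s \<in> {2..length ps}. (ii ps s = 0 \<and> jj ps s = 1) \<or>
      (1 \<le> ii ps s \<and> ii ps s \<le> n - 1 \<and> 1 \<le> jj ps s \<and> jj ps s \<le> n))"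

definition cond_b :: "(nat \<times> nat) list \<Rightarrow> bool" where
  "cond_b ps \<longleftrightarrow> (\<forall>s \<in> {2..length ps}. jj ps s \<le> jj ps (s - 1) \<and> ii ps (s - 1) \<le> ii ps s)"

definition cond_c :: "(nat \<times> nat) list \<Rightarrow> bool" where
  "cond_c ps \<longleftrightarrow> (\<forall>s \<in> {2..length ps}.
    (jj ps (s - 1) > ii ps (s - 1) + 1 \<longrightarrow> jj ps s < jj ps (s - 1)) \<and>
    (jj ps s > ii ps s + 1 \<longrightarrow> ii ps s > ii ps (s - 1)))"

definition brick_family :: "nat \<Rightarrow> (nat \<times> nat) list \<Rightarrow> bool" where
  "brick_family n ps \<longleftrightarrow> cond_a n ps \<and> cond_b ps \<and> cond_c ps"

end

theory Submission
  imports Defs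
begin

text \<open>
  The group acts on integer vectors with \<open>n + 1\<close> entries: \<open>\<sigma>\<^sub>i\<close> swaps two neighbouring entries, and the
  affine generator maps \<open>(x\<^sub>0, \<dots>, x\<^sub>n)\<close> to \<open>(x\<^sub>n + 1, x\<^sub>1, \<dots>, x\<^sub>0 - 1)\<close>. The orbit of the origin
  consists of the vectors with sum zero, and its stabiliser is \<open>W(A\<^sub>n)\<close>, so the cosets are the
  vectors with sum zero. The number \<open>depth x\<close> of hyperplanes that separate \<open>x\<close> from the
  fundamental alcove is the length of the distinguished representative, and the sum \<open>height x\<close> of
  the positive entries is its affine length. A brick \<open>\<B>(j, i)\<close> removes the two outer entries of a
  vector, increases the last one by one and reinserts it after \<open>i\<close> entries, decreases the first one
  by one and reinserts it after \<open>j - 1\<close> entries. Conditions (a), (b), (c) say exactly that, after each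
  brick, the entry inserted at \<open>j\<close> is the last negative one and the other one is the
  first positive one. Hence the family can be read off the vector.
\<close>

section \<open>The action on integer vectors\<close>

fun act :: "nat \<Rightarrow> gen \<Rightarrow> int list \<Rightarrow> int list" where
  "act n (Sig i) x = x[i - 1 := x ! i, i := x ! (i - 1)]"
| "act n Aff x = x[0 := x ! n + 1, n := x ! 0 - 1]"

definition act_word :: "nat \<Rightarrow> gen list \<Rightarrow> int list \<Rightarrow> int list" where
  "act_word n u x = foldr (act n) u x"

text \<open>The value of the simple affine root at \<open>x\<close>, positive if and only if \<open>s\<close> moves \<open>x\<close> towards the
  fundamental alcove.\<close>

fun gap :: "nat \<Rightarrow> gen \<Rightarrow> int list \<Rightarrow> int" where
  "gap n (Sig i) x = x ! i - x ! (i - 1)"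
| "gap n Aff x = x ! 0 - x ! n - 1"

fun coroot :: "nat \<Rightarrow> gen \<Rightarrow> nat \<Rightarrow> int" where
  "coroot n (Sig i) k = of_bool (k = i - 1) - of_bool (k = i)"
| "coroot n Aff k = of_bool (k = n) - of_bool (k = 0)"

text \<open>The number of hyperplanes \<open>x\<^sub>p - x\<^sub>q = k\<close>, for fixed \<open>p < q\<close>, that strictly separate a point with
  \<open>x\<^sub>p - x\<^sub>q = z\<close> from the fundamental alcove, where \<open>0 < x\<^sub>p - x\<^sub>q < 1\<close>.\<close>

definition sep :: "int \<Rightarrow> int" where
  "sep z = (if z > 0 then z - 1 else - z)"

fun depth :: "int list \<Rightarrow> int" where
  "depth [] = 0"
| "depth (a # x) = (\<Sum>b\<leftarrow>x. sep (a - b)) + depth x"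

definition height :: "int list \<Rightarrow> int" where
  "height x = (\<Sum>a\<leftarrow>x. max 0 a)"

lemma act_word_Nil [simp]: "act_word n [] x = x"
  and act_word_Cons [simp]: "act_word n (s # u) x = act n s (act_word n u x)"
  and act_word_append [simp]: "act_word n (u @ v) x = act_word n u (act_word n v x)"
  by (simp_all add: act_word_def)

lemma length_act [simp]: "length (act n s x) = length x"
  by (cases s) auto

lemma length_act_word [simp]: "length (act_word n u x) = length x"
  by (induction u) auto

section \<open>Change of \<open>depth\<close> when entries of a vector are moved\<close>

lemma sep_reflect: "sep (1 - z) = sep z"
  by (simp add: sep_def)

lemma depth_append: "depth (x @ y) = depth x + depth y + (\<Sum>a\<leftarrow>x. \<Sum>b\<leftarrow>y. sep (a - b))"
  by (induction x) auto

lemma adjacent_sym: "adjacent n s t \<longleftrightarrow> adjacent n t s"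
  by (cases s; cases t) auto

lemma sum_list_sep_less:
  "(\<forall>a\<in>set x. a < c) \<Longrightarrow> (\<Sum>a\<leftarrow>x. sep (a - c)) = (\<Sum>a\<leftarrow>x. sep (c - a)) + int (length x)"
  by (induction x) (auto simp: sep_def)

text \<open>Each passed entry \<open>a < c\<close> trades the contribution
  \<open>sep (c - a) = c - a - 1\<close> for \<open>sep (a - c) = c - a\<close>.\<close>

lemma depth_move_right:
  assumes "\<forall>a\<in>set x. a < c"
  shows "depth (x @ c # y) = depth (c # x @ y) + int (length x)"
  using sum_list_sep_less[OF assms] by (simp add: depth_append sum_list_addf)

lemma depth_move_left:
  assumes "\<forall>b\<in>set y. c < b"
  shows "depth (x @ c # y) = depth (x @ y @ [c]) + int (length y)"
proof -
  have "(\<Sum>b\<leftarrow>y. sep (c - b)) = (\<Sum>b\<leftarrow>y. sep (b - c)) + int (length y)"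
    using assms by (induction y) (auto simp: sep_def)
  then show ?thesis by (simp add: depth_append sum_list_addf algebra_simps)
qed

text \<open>The reflection in the affine wall permutes all other hyperplanes: an inner entry paired
  with one end is exchanged with the same entry paired with the other end, the difference
  \<open>z\<close> becoming \<open>1 - z\<close>. Only for the outer pair is a hyperplane, the
  affine wall, gained or lost.\<close>

lemma depth_ends:
  "depth ((b + 1) # r @ [a - 1]) = depth (a # r @ [b]) - sgn (a - b - 1)"
proof -
  have 1: "(\<Sum>c\<leftarrow>r. sep (b + 1 - c)) = (\<Sum>c\<leftarrow>r. sep (c - b))"
    using sep_reflect[of "_ - b"] by (intro arg_cong[of _ _ sum_list] map_cong) (auto simp: algebra_simps)
  have 2: "(\<Sum>c\<leftarrow>r. sep (c - (a - 1))) = (\<Sum>c\<leftarrow>r. sep (a - c))"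
    using sep_reflect[of "a - _"] by (intro arg_cong[of _ _ sum_list] map_cong) (auto simp: algebra_simps)
  have 3: "sep (b + 1 - (a - 1)) = sep (a - b) - sgn (a - b - 1)"
    by (auto simp: sep_def sgn_if)
  show ?thesis using 1 2 3 by (simp add: depth_append algebra_simps)
qed

lemma act_Sig_append:
  "length x = i - 1 \<Longrightarrow> 1 \<le> i \<Longrightarrow> act n (Sig i) (x @ a # b # y) = x @ b # a # y"
  by (auto simp: nth_append list_update_append nth_Cons' list_update.simps split: nat.splits)

lemma act_Aff_append:
  "length r = n - 1 \<Longrightarrow> 1 \<le> n \<Longrightarrow> act n Aff (a # r @ [b]) = (b + 1) # r @ [a - 1]"
  by (cases n) (auto simp: nth_append list_update_append)

locale affine_rank =
  fixes n :: nat
  assumes n2: "2 \<le> n"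
begin

abbreviation vec :: "int list \<Rightarrow> bool" where
  "vec x \<equiv> length x = Suc n"

abbreviation origin :: "int list" where
  "origin \<equiv> replicate (Suc n) 0"

abbreviation cong (infix "\<sim>\<^sub>C" 50) where
  "u \<sim>\<^sub>C v \<equiv> cox_eq (gens n) (cox_matrix n) u v"

lemma gens_cases:
  assumes "s \<in> gens n"
  obtains i where "s = Sig i" "1 \<le> i" "i \<le> n" | "s = Aff"
  using assms by (auto simp: gens_def)

lemma vec_cases:
  assumes "vec x"
  obtains a r b where "x = a # r @ [b]" "length r = n - 1"
proof -
  obtain a y where "x = a # y" using assms by (cases x) auto
  moreover obtain r b where "y = r @ [b]" using assms n2 calculation by (cases y rule: rev_cases) auto
  ultimately show thesis using that assms by auto
qed

lemma vec_cases_Sig: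
  assumes "vec x" "1 \<le> i" "i \<le> n"
  obtains y a b z where "x = y @ a # b # z" "length y = i - 1"
proof -
  have "x = take (i - 1) x @ x ! (i - 1) # x ! i # drop (i + 1) x"
    using assms by (metis Cons_nth_drop_Suc Suc_eq_plus1 append_take_drop_id le_add_diff_inverse2 less_Suc_eq_le less_imp_diff_less)
  then show thesis using that assms by (metis One_nat_def diff_le_self le_SucI le_trans length_take min.absorb2)
qed

section \<open>The generators as affine reflections\<close>

lemma act_act:
  assumes "vec x" "s \<in> gens n"
  shows "act n s (act n s x) = x"
  using assms n2 by (cases rule: gens_cases[OF assms(2)])
    (auto intro!: nth_equalityI simp: nth_list_update)

text \<open>In this form a generator is visibly an affine reflection. With the formulas for
  \<open>gap\<close> below, commutation and braid relations become comparisons of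
  coordinates.\<close>

lemma nth_act:
  assumes "vec x" "s \<in> gens n" "k \<le> n"
  shows "act n s x ! k = x ! k + gap n s x * coroot n s k"
  using assms n2 by (cases rule: gens_cases[OF assms(2)]) (auto simp: nth_list_update)

lemma gap_act_self:
  assumes "vec x" "s \<in> gens n"
  shows "gap n s (act n s x) = - gap n s x"
  using assms n2 by (cases rule: gens_cases[OF assms(2)]) (auto simp: nth_list_update)

lemma gap_act:
  assumes "vec x" "s \<in> gens n" "t \<in> gens n" "s \<noteq> t"
  shows "gap n t (act n s x) = gap n t x + (if adjacent n s t then gap n s x else 0)"
  using assms n2 by (cases rule: gens_cases[OF assms(2)]; cases rule: gens_cases[OF assms(3)])
    (auto simp: nth_list_update)

lemma act_fixed_iff:
  assumes "vec x" "s \<in> gens n"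
  shows "act n s x = x \<longleftrightarrow> gap n s x = 0"
proof
  assume "act n s x = x"
  then show "gap n s x = 0" using gap_act_self[OF assms] by simp
next
  assume "gap n s x = 0"
  then show "act n s x = x" using assms by (auto intro!: nth_equalityI simp: nth_act)
qed

lemma act_commute:
  assumes "vec x" "s \<in> gens n" "t \<in> gens n" "s \<noteq> t" "\<not> adjacent n s t"
  shows "act n s (act n t x) = act n t (act n s x)"
  using assms by (auto intro!: nth_equalityI simp: nth_act gap_act adjacent_sym[of n t])

lemma act_braid:
  assumes "vec x" "s \<in> gens n" "t \<in> gens n" "s \<noteq> t" "adjacent n s t"
  shows "act n s (act n t (act n s x)) = act n t (act n s (act n t x))"
  using assms by (auto intro!: nth_equalityI
      simp: nth_act gap_act gap_act_self adjacent_sym[of n t] algebra_simps)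

text \<open>Reflecting the point amounts to reflecting the fundamental alcove, and the two alcoves
  are separated only by the wall of \<open>s\<close>. The count changes by one, unless the point
  lies on that wall.\<close>

lemma depth_act:
  assumes "vec x" "s \<in> gens n"
  shows "depth (act n s x) = depth x - sgn (gap n s x)"
  using assms(2)
proof (cases rule: gens_cases)
  case (1 i)
  obtain y a b z where x: "x = y @ a # b # z" "length y = i - 1"
    using vec_cases_Sig[OF assms(1)] 1 by metis
  have "gap n s x = b - a" using x 1 by (auto simp: nth_append nth_Cons')
  moreover have "act n s x = y @ b # a # z" using act_Sig_append x 1 by auto
  ultimately show ?thesis using x by (simp add: depth_append sep_def sgn_if algebra_simps)
next
  case 2
  obtain a r b where x: "x = a # r @ [b]" "length r = n - 1" using vec_cases[OF assms(1)] by metis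
  have "gap n s x = a - b - 1" using x 2 n2 by (auto simp: nth_append nth_Cons')
  moreover have "act n s x = (b + 1) # r @ [a - 1]" using act_Aff_append x 2 n2 by auto
  ultimately show ?thesis using depth_ends x by simp
qed

lemma sum_list_act:
  assumes "vec x" "s \<in> gens n"
  shows "sum_list (act n s x) = sum_list x"
  using assms(2)
proof (cases rule: gens_cases)
  case (1 i)
  obtain y a b z where x: "x = y @ a # b # z" "length y = i - 1"
    using vec_cases_Sig[OF assms(1)] 1 by metis
  then show ?thesis using act_Sig_append 1 by simp
next
  case 2
  obtain a r b where x: "x = a # r @ [b]" "length r = n - 1" using vec_cases[OF assms(1)] by metis
  then show ?thesis using act_Aff_append 2 n2 by auto
qed

text \<open>Finite generators only permute entries. Of the two changes made by \<open>Aff\<close>,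
  the increase adds at most one to the positive part and the decrease adds nothing.\<close>

lemma height_act:
  assumes "vec x" "s \<in> gens n"
  shows "height (act n s x) \<le> height x + of_bool (s = Aff)"
  using assms(2)
proof (cases rule: gens_cases)
  case (1 i)
  obtain y a b z where x: "x = y @ a # b # z" "length y = i - 1"
    using vec_cases_Sig[OF assms(1)] 1 by metis
  have "act n s x = y @ b # a # z" using act_Sig_append x 1 by auto
  then show ?thesis using x by (simp add: height_def)
next
  case 2
  obtain a r b where x: "x = a # r @ [b]" "length r = n - 1" using vec_cases[OF assms(1)] by metis
  have "act n s x = (b + 1) # r @ [a - 1]" using act_Aff_append x 2 n2 by auto
  then show ?thesis using x 2 by (simp add: height_def)
qed

lemma sum_list_act_word:
  "vec x \<Longrightarrow> u \<in> lists (gens n) \<Longrightarrow> sum_list (act_word n u x) = sum_list x"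
  by (induction u) (auto simp: sum_list_act)

lemma act_word_rev:
  "vec x \<Longrightarrow> u \<in> lists (gens n) \<Longrightarrow> act_word n (rev u) (act_word n u x) = x"
  by (induction u) (auto simp: act_act)

lemma act_word_inj:
  assumes "vec x" "vec y" "u \<in> lists (gens n)" "act_word n u x = act_word n u y"
  shows "x = y"
  using act_word_rev assms by metis

text \<open>Relators act trivially, since generators act as involutions that satisfy the commutation
  and braid relations. Hence every group element has a well-defined image of the origin.\<close>

lemma act_word_cong:
  assumes "u \<sim>\<^sub>C v" "vec x"
  shows "act_word n u x = act_word n v x"
  using assms
proof induction
  case (relator u v s t)
  have *: "act_word n (concat (replicate (cox_matrix n s t) [s, t])) y = y" if y: "vec y" for y
  proof -
    consider "s = t" | "s \<noteq> t" "\<not> adjacent n s t" | "s \<noteq> t" "adjacent n s t" by blast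
    then show ?thesis
    proof cases
      case 1
      then show ?thesis using y relator by (simp add: cox_matrix_def act_act)
    next
      case 2
      then have "act n s (act n t y) = act n t (act n s y)"
        using act_commute[OF y] relator by blast
      with 2 show ?thesis using y relator by (simp add: cox_matrix_def act_act numeral_2_eq_2)
    next
      case 3
      then have "act n t (act n s (act n t y)) = act n s (act n t (act n s y))"
        using act_braid[OF y] relator by metis
      with 3 show ?thesis using y relator by (simp add: cox_matrix_def act_act numeral_3_eq_3)
    qed
  qed
  show ?case using * relator by simp
qed auto

section \<open>Rewriting words with the Coxeter relations\<close>

lemma cong_cancel:
  assumes "p \<in> lists (gens n)" "w \<in> lists (gens n)" "s \<in> gens n"
  shows "p @ s # s # w \<sim>\<^sub>C p @ w"
  using cox_eq.relator[of p "gens n" w s s "cox_matrix n"] assms by (simp add: cox_matrix_def)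

text \<open>The relator is inserted in front of the right-hand side, then squares cancel from the
  inside; the braid relation below is obtained in the same way.\<close>

lemma cong_commute:
  assumes "w \<in> lists (gens n)" "s \<in> gens n" "t \<in> gens n" "s \<noteq> t" "\<not> adjacent n s t"
  shows "s # t # w \<sim>\<^sub>C t # s # w"
proof -
  have "s # t # s # t # t # s # w \<sim>\<^sub>C t # s # w"
    using cox_eq.relator[of "[]" "gens n" "t # s # w" s t "cox_matrix n"] assms
    by (simp add: cox_matrix_def numeral_2_eq_2)
  moreover have "s # t # s # t # t # s # w \<sim>\<^sub>C s # t # s # s # w"
    using cong_cancel[of "[s, t, s]" "s # w" t] assms by simp
  moreover have "s # t # s # s # w \<sim>\<^sub>C s # t # w"
    using cong_cancel[of "[s, t]" w s] assms by simp
  ultimately show ?thesis by (meson cox_eq.sym cox_eq.trans)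
qed

lemma cong_braid:
  assumes "w \<in> lists (gens n)" "s \<in> gens n" "t \<in> gens n" "adjacent n s t"
  shows "s # t # s # w \<sim>\<^sub>C t # s # t # w"
proof -
  have ne: "s \<noteq> t" using assms(4) by (cases s; cases t) auto
  have "s # t # s # t # s # t # t # s # t # w \<sim>\<^sub>C t # s # t # w"
    using cox_eq.relator[of "[]" "gens n" "t # s # t # w" s t "cox_matrix n"] assms ne
    by (simp add: cox_matrix_def numeral_3_eq_3)
  moreover have "s # t # s # t # s # t # t # s # t # w \<sim>\<^sub>C s # t # s # t # s # s # t # w"
    using cong_cancel[of "[s, t, s, t, s]" "s # t # w" t] assms by simp
  moreover have "s # t # s # t # s # s # t # w \<sim>\<^sub>C s # t # s # t # t # w"
    using cong_cancel[of "[s, t, s, t]" "t # w" s] assms by simp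
  moreover have "s # t # s # t # t # w \<sim>\<^sub>C s # t # s # w"
    using cong_cancel[of "[s, t, s]" "w" t] assms by simp
  ultimately show ?thesis by (meson cox_eq.sym cox_eq.trans)
qed

lemma cong_Cons: "u \<sim>\<^sub>C v \<Longrightarrow> s \<in> gens n \<Longrightarrow> s # u \<sim>\<^sub>C s # v"
  using cox_eq_append_left[of "gens n" "cox_matrix n" u v "[s]"] by simp

section \<open>Lower bounds for Coxeter length and affine length\<close>

lemma depth_origin: "depth origin = 0"
proof -
  have "depth (replicate m 0) = 0" for m by (induction m) (auto simp: sep_def map_replicate_const sum_list_replicate)
  then show ?thesis .
qed

lemma height_origin: "height origin = 0"
  by (simp add: height_def sum_list_replicate)

lemma depth_le_length:
  "u \<in> lists (gens n) \<Longrightarrow> depth (act_word n u origin) \<le> int (length u)"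
proof (induction u)
  case Nil
  show ?case using depth_origin by simp
next
  case (Cons s u)
  then show ?case using depth_act[of "act_word n u origin" s] by (auto simp: sgn_if split: if_splits)
qed

lemma height_le_count:
  "u \<in> lists (gens n) \<Longrightarrow> height (act_word n u origin) \<le> int (count_list u Aff)"
proof (induction u)
  case Nil
  show ?case using height_origin by simp
next
  case (Cons s u)
  then show ?case using height_act[of "act_word n u origin" s] by auto
qed

end

section \<open>Greedy bricks\<close>

text \<open>Lists are indexed from 0, so the entry inserted at \<open>j\<close> has index \<open>j - 1\<close>. The index \<open>i\<close> refers to
  the list without that entry, and \<open>p\<close> is the corresponding index in \<open>x\<close>.\<close>

definition greedy :: "int list \<Rightarrow> nat \<Rightarrow> nat \<Rightarrow> bool" where
  "greedy x j i \<longleftrightarrow> 1 \<le> j \<and> j \<le> length x \<and> x ! (j - 1) < 0 \<and>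
    (\<forall>k<length x. j \<le> k \<longrightarrow> 0 \<le> x ! k) \<and>
    (let p = if i + 1 < j then i else i + 1 in
      p < length x \<and> 0 < x ! p \<and> (\<forall>k<p. x ! k \<le> 0))"

text \<open>The demands of (a), (b), (c) at a single index from 2 on, with \<open>q\<close> the pair
  at that index and \<open>p\<close> its predecessor.\<close>

definition link :: "nat \<Rightarrow> nat \<times> nat \<Rightarrow> nat \<times> nat \<Rightarrow> bool" where
  "link n p q \<longleftrightarrow> (case (p, q) of ((j, i), (j', i')) \<Rightarrow>
    (i' = 0 \<and> j' = 1 \<or> 1 \<le> i' \<and> i' \<le> n - 1 \<and> 1 \<le> j' \<and> j' \<le> n) \<and>
    j' \<le> j \<and> i \<le> i' \<and> (j > i + 1 \<longrightarrow> j' < j) \<and> (j' > i' + 1 \<longrightarrow> i' > i))"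

lemma brick_word_Nil [simp]: "brick_word n [] = []"
  and brick_word_Cons [simp]: "brick_word n (p # ps) = brick n (fst p) (snd p) @ brick_word n ps"
  by (simp_all add: brick_word_def case_prod_unfold)

text \<open>The entry at \<open>j - 1\<close> is the last negative one and the entry at
  \<open>p\<close> the first positive one, so \<open>x\<close> determines both positions, and
  \<open>j\<close> and \<open>p\<close> determine \<open>i\<close>.\<close>

lemma greedy_unique:
  assumes "greedy x j i" "greedy x j' i'"
  shows "j = j' \<and> i = i'"
proof -
  define p where "p = (if i + 1 < j then i else i + 1)"
  define p' where "p' = (if i' + 1 < j' then i' else i' + 1)"
  have g: "1 \<le> j" "j \<le> length x" "x ! (j - 1) < 0" "\<And>k. k < length x \<Longrightarrow> j \<le> k \<Longrightarrow> 0 \<le> x ! k"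
      "p < length x" "0 < x ! p" "\<And>k. k < p \<Longrightarrow> x ! k \<le> 0"
    using assms(1) by (auto simp: greedy_def p_def Let_def)
  have g': "1 \<le> j'" "j' \<le> length x" "x ! (j' - 1) < 0" "\<And>k. k < length x \<Longrightarrow> j' \<le> k \<Longrightarrow> 0 \<le> x ! k"
      "p' < length x" "0 < x ! p'" "\<And>k. k < p' \<Longrightarrow> x ! k \<le> 0"
    using assms(2) by (auto simp: greedy_def p'_def Let_def)
  have "\<not> j - 1 < j' - 1" using g(4)[of "j' - 1"] g'(1,2,3) by force
  moreover have "\<not> j' - 1 < j - 1" using g'(4)[of "j - 1"] g(1,2,3) by force
  ultimately have j: "j = j'" using g(1) g'(1) by linarith
  have "p = p'" using g(6) g(7)[of p'] g'(6) g'(7)[of p] by (metis linorder_neqE_nat not_less)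
  moreover have "p \<noteq> j - 1" "p' \<noteq> j' - 1" using g g' by auto
  ultimately have "i = i'" using j g(1) by (auto simp: p_def p'_def split: if_splits)
  with j show ?thesis by blast
qed

lemma greedy_exists:
  assumes "sum_list x = 0" "\<exists>a\<in>set x. a \<noteq> 0"
  shows "\<exists>j i. greedy x j i"
proof -
  have pos: "\<exists>a\<in>set y. 0 < a" if "sum_list y = 0" "\<exists>a\<in>set y. a \<noteq> 0" for y :: "int list"
  proof (rule ccontr)
    assume "\<not> ?thesis"
    then have "\<forall>a\<in>set y. a \<le> 0" by auto
    then have "sum_list y \<le> 0 \<and> (sum_list y = 0 \<longrightarrow> (\<forall>a\<in>set y. a = 0))"
      by (induction y) auto
    then show False using that by auto
  qed
  have neg: "\<exists>a\<in>set x. a < 0"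
    using pos[of "map uminus x"] assms uminus_sum_list_map[of id x] by auto
  define q where "q = (GREATEST k. k < length x \<and> x ! k < 0)"
  obtain k where k: "k < length x \<and> x ! k < 0" using neg by (auto simp: in_set_conv_nth)
  have q: "q < length x \<and> x ! q < 0"
    unfolding q_def by (rule GreatestI_nat[where P = "\<lambda>k. k < length x \<and> x ! k < 0" and b = "length x", OF k]) auto
  have q': "k \<le> q" if "k < length x \<and> x ! k < 0" for k
    unfolding q_def by (rule Greatest_le_nat[where P = "\<lambda>k. k < length x \<and> x ! k < 0" and b = "length x", OF that]) auto
  define p where "p = (LEAST k. k < length x \<and> 0 < x ! k)"
  obtain k' where k': "k' < length x \<and> 0 < x ! k'"
    using pos[OF assms] by (auto simp: in_set_conv_nth)
  have p: "p < length x \<and> 0 < x ! p"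
    unfolding p_def by (rule LeastI[where P = "\<lambda>k. k < length x \<and> 0 < x ! k", OF k'])
  have p': "p \<le> k" if "k < length x \<and> 0 < x ! k" for k
    unfolding p_def by (rule Least_le[where P = "\<lambda>k. k < length x \<and> 0 < x ! k", OF that])
  have "p \<noteq> q" using p q by auto
  moreover have "0 \<le> x ! k" if "k < length x" "q + 1 \<le> k" for k
    using q'[of k] that by force
  moreover have "x ! k \<le> 0" if "k < p" for k
    using p'[of k] p that by force
  \<comment> \<open>Deleting the entry at \<open>q\<close> lowers the later indices by one, whence
    \<open>p - 1\<close>.\<close>
  ultimately have "greedy x (q + 1) (if p < q then p else p - 1)"
    using p q by (auto simp: greedy_def Let_def)
  then show ?thesis by blast
qed

section \<open>Conditions (a), (b), (c) as a recursion on the list\<close>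

lemma cond_a_Cons:
  "cond_a n ((j, i) # ps) \<longleftrightarrow> 1 \<le> j \<and> j \<le> n + 1 \<and> i \<le> n - 1 \<and>
    (\<forall>p\<in>set ps. snd p = 0 \<and> fst p = 1 \<or> 1 \<le> snd p \<and> snd p \<le> n - 1 \<and> 1 \<le> fst p \<and> fst p \<le> n)"
proof -
  have "(\<forall>s\<in>{2..Suc (length ps)}. P (((j, i) # ps) ! (s - 1))) \<longleftrightarrow> (\<forall>p\<in>set ps. P p)" for P
  proof
    assume *: "\<forall>s\<in>{2..Suc (length ps)}. P (((j, i) # ps) ! (s - 1))"
    show "\<forall>p\<in>set ps. P p"
    proof
      fix p assume "p \<in> set ps"
      then obtain k where "k < length ps" "ps ! k = p" by (auto simp: in_set_conv_nth)
      then show "P p" using *[rule_format, of "k + 2"] by simp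
    qed
  qed (auto simp: nth_Cons')
  from this[of "\<lambda>p. snd p = 0 \<and> fst p = 1 \<or> 1 \<le> snd p \<and> snd p \<le> n - 1 \<and> 1 \<le> fst p \<and> fst p \<le> n"]
  show ?thesis unfolding cond_a_def jj_def ii_def by auto
qed

lemma ball_pairs_Cons:
  "(\<forall>s\<in>{2..length (p # q # ps)}. P ((p # q # ps) ! (s - 2)) ((p # q # ps) ! (s - 1))) \<longleftrightarrow>
    P p q \<and> (\<forall>s\<in>{2..length (q # ps)}. P ((q # ps) ! (s - 2)) ((q # ps) ! (s - 1)))"
proof -
  have "{2..length (p # q # ps)} = insert 2 (Suc ` {2..length (q # ps)})"
    by (auto simp: image_iff Bex_def)
  then have *: "(\<forall>s\<in>{2..length (p # q # ps)}. Q s) \<longleftrightarrow>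
      Q 2 \<and> (\<forall>s\<in>{2..length (q # ps)}. Q (Suc s))" for Q
    by (simp only: ball_simps)
  have "(p # q # ps) ! (Suc s - 2) = (q # ps) ! (s - 2) \<and>
      (p # q # ps) ! (Suc s - 1) = (q # ps) ! (s - 1)" if "s \<in> {2..length (q # ps)}" for s
    using that by (auto simp: nth_Cons' Suc_diff_le numeral_2_eq_2 numeral_3_eq_3)
  then show ?thesis unfolding *[of "\<lambda>s. P ((p # q # ps) ! (s - 2)) ((p # q # ps) ! (s - 1))"]
    by (intro arg_cong2[where f = "(\<and>)"] ball_cong) auto
qed

text \<open>(b) and (c) compare neighbours only, so they form a chain condition. The tail is again a
  family because what (a) demands of later pairs implies what it demands of a first pair.\<close>

lemma brick_family_Cons:
  "brick_family n ((j, i) # ps) \<longleftrightarrow> 1 \<le> j \<and> j \<le> n + 1 \<and> i \<le> n - 1 \<and>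
    (ps = [] \<or> link n (j, i) (hd ps) \<and> brick_family n ps)"
proof (cases ps)
  case Nil
  then show ?thesis by (auto simp: brick_family_def cond_a_Cons cond_b_def cond_c_def)
next
  case (Cons q qs)
  obtain j' i' where q: "q = (j', i')" by (cases q)
  define P where "P = (\<lambda>p q :: nat \<times> nat. fst q \<le> fst p \<and> snd p \<le> snd q \<and>
    (fst p > snd p + 1 \<longrightarrow> fst q < fst p) \<and> (fst q > snd q + 1 \<longrightarrow> snd q > snd p))"
  have bc: "cond_b ps \<and> cond_c ps \<longleftrightarrow> (\<forall>s\<in>{2..length ps}. P (ps ! (s - 2)) (ps ! (s - 1)))" for ps
    unfolding cond_b_def cond_c_def P_def jj_def ii_def
    by (auto simp: numeral_2_eq_2)
  show ?thesis
    using ball_pairs_Cons[of "(j, i)" q qs P] unfolding brick_family_def bc Cons q cond_a_Cons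
    by (auto simp: link_def P_def)
qed

context affine_rank
begin

section \<open>The effect of one brick on a vector\<close>

lemma act_down_word:
  "length x = i \<Longrightarrow> act_word n (down_word i 1) (c # x @ y) = x @ c # y"
proof (induction i arbitrary: x y)
  case 0
  then show ?case by (simp add: down_word_def)
next
  case (Suc i)
  then obtain x' a where x: "x = x' @ [a]" "length x' = i" by (cases x rule: rev_cases) auto
  have "down_word (Suc i) 1 = Sig (Suc i) # down_word i 1" by (simp add: down_word_def)
  then show ?case using Suc.IH[of x' "a # y"] x act_Sig_append[of x' "Suc i" n c a y] by simp
qed

lemma act_up_word:
  "length x = j - 1 \<Longrightarrow> 1 \<le> j \<Longrightarrow> length (x @ y) = n \<Longrightarrow>
    act_word n (up_word j n) (x @ y @ [c]) = x @ c # y"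
proof (induction y arbitrary: x j)
  case Nil
  then have "j = Suc n" by simp
  then show ?case by (simp add: up_word_def)
next
  case (Cons b y)
  then have "up_word j n = Sig j # up_word (Suc j) n" by (simp add: up_word_def upt_conv_Cons)
  then show ?case using Cons.IH[of "x @ [b]" "Suc j"] Cons.prems act_Sig_append[of x j n b c y]
    by simp
qed

text \<open>Words act from the right: \<open>Aff\<close> exchanges and shifts the ends,
  \<open>down_word\<close> carries the new first entry \<open>b + 1\<close> past \<open>z\<close>,
  and \<open>up_word\<close> carries the new last entry \<open>a - 1\<close> back to index
  \<open>j - 1\<close>. The list \<open>x @ y\<close> is the state between the last two moves
  without \<open>a - 1\<close>.\<close>

lemma act_brick:
  assumes "length z = i" "length (z @ w) = n - 1" "z @ (b + 1) # w = x @ y" "length x = j - 1" "1 \<le> j"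
  shows "act_word n (brick n j i) (a # z @ w @ [b]) = x @ (a - 1) # y"
proof -
  have "length (x @ y) = n" using arg_cong[OF assms(3), of length] assms(2) n2 by simp
  then have "act_word n (up_word j n) (x @ y @ [a - 1]) = x @ (a - 1) # y"
    using act_up_word assms by blast
  moreover have "act_word n (down_word i 1) ((b + 1) # z @ w @ [a - 1]) = x @ y @ [a - 1]"
    using act_down_word[OF assms(1), of "b + 1" "w @ [a - 1]"] assms(3)
    by (metis append.assoc append_Cons)
  moreover have "act n Aff (a # z @ w @ [b]) = (b + 1) # z @ w @ [a - 1]"
    using act_Aff_append[of "z @ w" n a b] assms(2) n2 by simp
  ultimately show ?thesis by (simp add: brick_def h_word_def)
qed

text \<open>Here \<open>m\<close> is the index after deletion of the entry at \<open>j - 1\<close>: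
  inner entries of \<open>v\<close> before the inserted \<open>b + 1\<close> have moved one place to
  the left, the others have kept their place. The truncated \<open>k - 1\<close> at
  \<open>k = j - 1 = 0\<close> is never consulted.\<close>

lemma nth_brick:
  assumes "vec v" "1 \<le> j" "j \<le> n + 1" "i \<le> n - 1" "k \<le> n"
  defines "m \<equiv> (if k < j - 1 then k else k - 1)"
  shows "act_word n (brick n j i) v ! k =
    (if k = j - 1 then v ! 0 - 1 else if m = i then v ! n + 1
     else if m < i then v ! (m + 1) else v ! m)"
proof -
  obtain a r b where v: "v = a # r @ [b]" "length r = n - 1" using vec_cases assms(1) by metis
  define z where "z = take i r"
  define w where "w = drop i r"
  have r: "r = z @ w" "length z = i" using v assms by (simp_all add: z_def w_def)
  define x where "x = take (j - 1) (z @ (b + 1) # w)"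
  define y where "y = drop (j - 1) (z @ (b + 1) # w)"
  have xy: "z @ (b + 1) # w = x @ y" by (simp only: x_def y_def append_take_drop_id)
  have x: "length x = j - 1" using assms v n2 r by (simp add: x_def)
  have "act_word n (brick n j i) v = x @ (a - 1) # y"
    using act_brick[of z i w b x y j a] xy x v r assms by simp
  moreover have "(x @ (a - 1) # y) ! k = (if k = j - 1 then a - 1 else (x @ y) ! m)"
    using x by (auto simp: nth_append nth_Cons' m_def)
  moreover have "(x @ y) ! m = (if m = i then b + 1 else if m < i then r ! m else r ! (m - 1))"
    unfolding xy[symmetric] using r by (auto simp: nth_append nth_Cons')
  moreover have "v ! 0 = a" "v ! n = b" "\<And>l. 1 \<le> l \<Longrightarrow> l < n \<Longrightarrow> v ! l = r ! (l - 1)"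
    using v n2 by (auto simp: nth_append nth_Cons')
  moreover have "m < n" if "k \<noteq> j - 1" using that assms n2 by (auto simp: m_def)
  ultimately show ?thesis using assms(4) n2 by auto
qed

text \<open>The outer entries become the negative \<open>y ! 0 - 1\<close> and the positive
  \<open>y ! n + 1\<close>. By \<open>nth_brick\<close>, \<open>nonneg\<close> covers every inner
  entry that lands behind the former, and \<open>nonpos\<close> every inner entry that lands before
  the latter.\<close>

lemma greedy_brick:
  assumes "vec y" "1 \<le> j" "j \<le> n + 1" "i \<le> n - 1"
    and ends: "y ! 0 \<le> 0" "0 \<le> y ! n"
    and nonneg: "\<And>k. k \<le> n \<Longrightarrow> j \<le> k \<or> j \<le> k + 1 \<and> i < k \<Longrightarrow> 0 \<le> y ! k"
    and nonpos: "\<And>k. k \<le> i \<Longrightarrow> y ! k \<le> 0"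
  shows "greedy (act_word n (brick n j i) y) j i"
proof -
  let ?x = "act_word n (brick n j i) y"
  define p where "p = (if i + 1 < j then i else i + 1)"
  note nth = nth_brick[OF assms(1-4)]
  have "?x ! (j - 1) < 0" using nth[of "j - 1"] ends(1) assms(2,3) by simp
  moreover have "0 \<le> ?x ! k" if "k \<le> n" "j \<le> k" for k
    using that nth[of k] ends assms(2) nonneg[of k] nonneg[of "k - 1"] by auto
  moreover have "0 < ?x ! p" "p \<le> n"
    using nth[of p] ends assms n2 by (auto simp: p_def split: if_splits)
  moreover have "?x ! k \<le> 0" if "k < p" for k
    using that nth[of k] ends assms(2-4) nonpos[of k] nonpos[of "k + 1"] n2
    by (auto simp: p_def split: if_splits)
  ultimately show ?thesis using assms(1-3) by (auto simp: greedy_def Let_def p_def)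
qed

lemma greedy_brick_origin:
  assumes "1 \<le> j" "j \<le> n + 1" "i \<le> n - 1"
  shows "greedy (act_word n (brick n j i) origin) j i"
  using assms n2 by (intro greedy_brick) (auto simp del: replicate_Suc)

lemma greedy_brick_link:
  assumes "vec y" "1 \<le> j" "j \<le> n + 1" "i \<le> n - 1" "greedy y j' i'" "link n (j, i) (j', i')"
  shows "greedy (act_word n (brick n j i) y) j i"
proof -
  define p' where "p' = (if i' + 1 < j' then i' else i' + 1)"
  have g': "1 \<le> j'" "j' \<le> n + 1" "y ! (j' - 1) < 0" "\<And>k. k \<le> n \<Longrightarrow> j' \<le> k \<Longrightarrow> 0 \<le> y ! k"
      "p' \<le> n" "0 < y ! p'" "\<And>k. k < p' \<Longrightarrow> y ! k \<le> 0"
    using assms(5) assms(1) by (auto simp: greedy_def p'_def Let_def)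
  have l: "i' = 0 \<and> j' = 1 \<or> 1 \<le> i' \<and> i' \<le> n - 1 \<and> 1 \<le> j' \<and> j' \<le> n"
     "j' \<le> j" "i \<le> i'" "j > i + 1 \<Longrightarrow> j' < j" "j' > i' + 1 \<Longrightarrow> i' > i"
    using assms(6) by (auto simp: link_def)
  \<comment> \<open>If \<open>p' = i'\<close>, then \<open>j' > i' + 1\<close>, and the second half
    of (c) gives \<open>i < i'\<close>; otherwise \<open>p' = i' + 1\<close>.\<close>
  have "i < p'" using l by (auto simp: p'_def)
  show ?thesis
  proof (rule greedy_brick[OF assms(1-4)])
    show "y ! 0 \<le> 0" using g'(7)[of 0] \<open>i < p'\<close> by simp
    show "0 \<le> y ! n" using g'(4)[of n] l n2 by auto
    \<comment> \<open>For \<open>j = k + 1\<close> the bound \<open>i < k\<close> says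
      \<open>j > i + 1\<close>, so the first half of (c) gives \<open>j' \<le> k\<close>.\<close>
    show "0 \<le> y ! k" if "k \<le> n" "j \<le> k \<or> j \<le> k + 1 \<and> i < k" for k
      using g'(4)[of k] that l by linarith
    show "y ! k \<le> 0" if "k \<le> i" for k using g'(7) that \<open>i < p'\<close> by simp
  qed
qed

text \<open>Converse of \<open>greedy_brick_link\<close>: the last negative and the first positive
  entry of \<open>y\<close>, where they are inner, survive in the new vector, and greediness
  confines their positions there. Translated back to \<open>y\<close>, these bounds are the
  inequalities of \<open>link\<close>.\<close>

lemma link_of_greedy:
  assumes "vec y" "1 \<le> j" "j \<le> n + 1" "i \<le> n - 1"
    and "greedy (act_word n (brick n j i) y) j i" "greedy y j' i'"
  shows "link n (j, i) (j', i')"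
proof -
  let ?x = "act_word n (brick n j i) y"
  note nth = nth_brick[OF assms(1-4)]
  define p where "p = (if i + 1 < j then i else i + 1)"
  define p' where "p' = (if i' + 1 < j' then i' else i' + 1)"
  have g: "?x ! (j - 1) < 0" "\<And>k. k \<le> n \<Longrightarrow> j \<le> k \<Longrightarrow> 0 \<le> ?x ! k"
      "p \<le> n" "0 < ?x ! p" "\<And>k. k < p \<Longrightarrow> ?x ! k \<le> 0"
    using assms(5) assms(1) by (auto simp: greedy_def p_def Let_def)
  have g': "1 \<le> j'" "j' \<le> n + 1" "y ! (j' - 1) < 0" "\<And>k. k \<le> n \<Longrightarrow> j' \<le> k \<Longrightarrow> 0 \<le> y ! k"
      "p' \<le> n" "0 < y ! p'" "\<And>k. k < p' \<Longrightarrow> y ! k \<le> 0"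
    using assms(6) assms(1) by (auto simp: greedy_def p'_def Let_def)
  have y0: "y ! 0 \<le> 0" using nth[of "j - 1"] g(1) assms by simp
  have yn: "0 \<le> y ! n" using nth[of p] g(3,4) assms(2) by (auto simp: p_def split: if_splits)
  \<comment> \<open>Inverse of \<open>nth_brick\<close> on inner entries: \<open>k\<close> is the
    new index of the entry at \<open>l\<close>.\<close>
  have inner: "\<exists>k\<le>n. ?x ! k = y ! l \<and> k = (let m = if l \<le> i then l - 1 else l in if m < j - 1 then m else m + 1)"
    if "1 \<le> l" "l < n" for l
  proof -
    define m where "m = (if l \<le> i then l - 1 else l)"
    define k where "k = (if m < j - 1 then m else m + 1)"
    have "k \<le> n" using that by (auto simp: k_def m_def)
    moreover have "?x ! k = y ! l" using nth[of k] \<open>k \<le> n\<close> that assms(2)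
      by (auto simp: k_def m_def split: if_splits)
    ultimately show ?thesis unfolding Let_def k_def m_def by blast
  qed
  have jn: "j' \<le> n" using g'(1-3) yn by (cases "j' = n + 1") auto
  have "1 \<le> p'" using y0 g'(6) by (cases p') auto
  have j: "j' \<le> j \<and> (j > i + 1 \<longrightarrow> j' < j)"
  proof (cases "j' = 1")
    case False
    then obtain k where k: "k \<le> n" "?x ! k = y ! (j' - 1)"
        "k = (let m = if j' - 1 \<le> i then j' - 1 - 1 else j' - 1 in if m < j - 1 then m else m + 1)"
      using inner[of "j' - 1"] g'(1) jn by auto
    then have "k < j" using g(2)[of k] g'(3) by linarith
    \<comment> \<open>The index \<open>k\<close> skips \<open>j - 1\<close>, so in fact
      \<open>k < j - 1\<close>; the claim follows by comparing \<open>j' - 1\<close> with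
      \<open>i\<close>.\<close>
    then show ?thesis using k(3) False g'(1) assms(2) by (auto simp: Let_def split: if_splits)
  qed (use assms in auto)
  have "i < p'"
  proof (cases "p' = n")
    case False
    then obtain k where k: "k \<le> n" "?x ! k = y ! p'"
        "k = (let m = if p' \<le> i then p' - 1 else p' in if m < j - 1 then m else m + 1)"
      using inner[of p'] \<open>1 \<le> p'\<close> g'(5) by auto
    then have "p \<le> k" using g(5)[of k] g'(6) by linarith
    then show ?thesis using k(3) \<open>1 \<le> p'\<close> assms(2) by (auto simp: p_def Let_def split: if_splits)
  qed (use assms n2 in auto)
  \<comment> \<open>Given \<open>1 \<le> p'\<close>, the value \<open>i' = 0\<close> forces
    \<open>p' = 1\<close> and \<open>j' = 1\<close>, the first alternative of (a). The case
    \<open>p' = i'\<close> is the premise of the second half of (c).\<close>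
  then show ?thesis using j jn g'(1,5) \<open>1 \<le> p'\<close> by (auto simp: link_def p'_def split: if_splits)
qed

text \<open>The brick is undone: the last negative entry goes to the right end, the first positive
  one to the left end, then \<open>Aff\<close> is applied. The signs make every comparison strict,
  so each letter accounts for exactly one hyperplane.\<close>

lemma greedy_brick_cover:
  assumes "vec x" "greedy x j i"
  obtains y where "vec y" "act_word n (brick n j i) y = x"
    "depth x = depth y + int (length (brick n j i))" "height x = height y + 1"
    "sum_list y = sum_list x" "1 \<le> j" "j \<le> n + 1" "i \<le> n - 1"
proof -
  define p where "p = (if i + 1 < j then i else i + 1)"
  have g: "1 \<le> j" "j \<le> n + 1" "x ! (j - 1) < 0" "\<And>k. k \<le> n \<Longrightarrow> j \<le> k \<Longrightarrow> 0 \<le> x ! k"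
      "p \<le> n" "0 < x ! p" "\<And>k. k < p \<Longrightarrow> x ! k \<le> 0"
    using assms by (auto simp: greedy_def p_def Let_def)
  define A where "A = take (j - 1) x"
  define B where "B = drop j x"
  define v where "v = x ! (j - 1)"
  have x: "x = A @ v # B" using id_take_nth_drop[of "j - 1" x] g(1,2) assms(1)
    by (simp add: A_def B_def v_def)
  have lA: "length A = j - 1" using g assms by (simp add: A_def)
  have lAB: "length (A @ B) = n" using x assms by simp
  have AB: "(A @ B) ! k = x ! (if k < j - 1 then k else k + 1)" for k
    unfolding x using lA by (auto simp: nth_append)
  have i: "i \<le> n - 1" using g by (auto simp: p_def split: if_splits)
  define C where "C = take i (A @ B)"
  define E where "E = drop (Suc i) (A @ B)"
  define u where "u = (A @ B) ! i"
  have CE: "A @ B = C @ u # E" using id_take_nth_drop[of i "A @ B"] lAB i n2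
    unfolding C_def E_def u_def by simp
  have lC: "length C = i" using lAB i by (simp add: C_def)
  have u: "0 < u" unfolding u_def AB using g(6) by (auto simp: p_def split: if_splits)
  have v: "v < 0" using g by (simp add: v_def)
  have Bv: "\<forall>b\<in>set B. v < b"
  proof
    fix b assume "b \<in> set B"
    then obtain k where k: "k < length B" "b = x ! (j + k)"
      using g assms(1) by (auto simp: B_def in_set_conv_nth)
    then have "j + k \<le> n" using g(2) assms(1) by (simp add: B_def)
    then show "v < b" using g(4)[of "j + k"] v k(2) by simp
  qed
  have Cu: "\<forall>c\<in>set C. c < u"
  proof
    fix c assume "c \<in> set C"
    then obtain k where "k < length C" "c = C ! k" by (metis in_set_conv_nth)
    then have k: "k < i" "c = (A @ B) ! k" using lC by (simp_all add: C_def del: take_append)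
    then have "c \<le> 0" unfolding k(2) AB by (intro g(7)) (auto simp: p_def split: if_splits)
    then show "c < u" using u by simp
  qed
  define y where "y = (v + 1) # C @ E @ [u - 1]"
  have lCE: "length (C @ E) = n - 1" using CE lAB by simp
  have "vec y" using lCE n2 by (simp add: y_def)
  moreover have "act_word n (brick n j i) y = x"
    using act_brick[OF lC lCE, of "u - 1" A B j "v + 1"] CE lA g(1) by (simp add: y_def x)
  moreover have "depth x = depth y + int (length (brick n j i))"
  proof -
    \<comment> \<open>The letters of \<open>up_word\<close>, those of \<open>down_word\<close> and
      \<open>Aff\<close> contribute \<open>length B\<close>, \<open>i\<close> and 1.\<close>
    have "depth x = depth (A @ B @ [v]) + int (length B)" unfolding x using depth_move_left[OF Bv] .
    also have "A @ B @ [v] = C @ u # E @ [v]" using CE by (metis append.assoc append_Cons)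
    also have "depth (C @ u # E @ [v]) = depth (u # (C @ E) @ [v]) + int i"
      using depth_move_right[OF Cu] lC by simp
    also have "depth (u # (C @ E) @ [v]) = depth y + 1"
      using depth_ends[of v "C @ E" u] u v by (simp add: y_def sgn_if)
    finally show ?thesis using assms(1) g(1,2)
      by (simp add: brick_def h_word_def up_word_def down_word_def B_def)
  qed
  moreover have "height x = height y + 1" "sum_list y = sum_list x"
  proof -
    have *: "(\<Sum>a\<leftarrow>A. f a) + (\<Sum>a\<leftarrow>B. f a) = (\<Sum>a\<leftarrow>C. f a) + f u + (\<Sum>a\<leftarrow>E. f a)" for f :: "int \<Rightarrow> int"
      using arg_cong[OF CE, of "\<lambda>z. sum_list (map f z)"] by simp
    \<comment> \<open>Since \<open>v < 0 < u\<close> are integers, \<open>u - 1\<close> is still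
      nonnegative and \<open>v + 1\<close> still not positive.\<close>
    show "height x = height y + 1"
      using *[of "max 0"] u v unfolding x y_def height_def by simp
    show "sum_list y = sum_list x"
      using *[of id] unfolding x y_def by (simp add: list.map_id)
  qed
  ultimately show thesis using that g i by blast
qed

section \<open>Bijection between brick families and vectors with sum zero\<close>

lemma brick_in_gens:
  assumes "1 \<le> j" "i \<le> n - 1"
  shows "brick n j i \<in> lists (gens n)"
  using assms n2 by (auto simp: brick_def h_word_def up_word_def down_word_def gens_def)

lemma brick_word_in_gens: "brick_family n ps \<Longrightarrow> brick_word n ps \<in> lists (gens n)"
proof (induction ps)
  case (Cons p ps)
  then have "1 \<le> fst p" "snd p \<le> n - 1" "ps = [] \<or> brick_family n ps"
    using brick_family_Cons[of n "fst p" "snd p" ps] by auto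
  then show ?case using Cons.IH brick_in_gens[of "fst p" "snd p"] by auto
qed simp

text \<open>The rightmost brick acts first. By \<open>link\<close> each further brick stays greedy,
  and a greedy brick adds its length to the depth and one to the height.\<close>

lemma brick_family_greedy:
  assumes "brick_family n ps"
  defines "x \<equiv> act_word n (brick_word n ps) origin"
  shows "(ps \<noteq> [] \<longrightarrow> greedy x (fst (hd ps)) (snd (hd ps))) \<and>
    depth x = int (length (brick_word n ps)) \<and> height x = int (length ps)"
  using assms(1) unfolding x_def
proof (induction ps)
  case Nil
  then show ?case using depth_origin height_origin by simp
next
  case (Cons p ps)
  obtain j i where p: "p = (j, i)" by (cases p)
  let ?y = "act_word n (brick_word n ps) origin"
  have c: "1 \<le> j" "j \<le> n + 1" "i \<le> n - 1" "ps = [] \<or> link n (j, i) (hd ps) \<and> brick_family n ps"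
    using Cons.prems unfolding p brick_family_Cons by auto
  have y: "vec ?y" by simp
  have "ps = [] \<or> brick_family n ps" using c by blast
  then have IH: "ps \<noteq> [] \<longrightarrow> greedy ?y (fst (hd ps)) (snd (hd ps))"
      "depth ?y = int (length (brick_word n ps))" "height ?y = int (length ps)"
    using Cons.IH depth_origin height_origin by (auto simp del: replicate_Suc)
  have g: "greedy (act_word n (brick n j i) ?y) j i"
  proof (cases "ps = []")
    case True
    then show ?thesis using greedy_brick_origin c by (simp del: replicate_Suc)
  next
    case False
    then show ?thesis using greedy_brick_link[OF y c(1-3)] IH(1) c(4) by (metis prod.collapse)
  qed
  have "vec (act_word n (brick n j i) ?y)" by simp
  from greedy_brick_cover[OF this g] obtain z where z: "vec z"
    "act_word n (brick n j i) z = act_word n (brick n j i) ?y"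
    "depth (act_word n (brick n j i) ?y) = depth z + int (length (brick n j i))"
    "height (act_word n (brick n j i) ?y) = height z + 1" by metis
  \<comment> \<open>\<open>greedy_brick_cover\<close> yields only some preimage \<open>z\<close>;
    injectivity of the action identifies it with \<open>?y\<close>.\<close>
  then have "z = ?y" using act_word_inj[OF z(1) y] brick_in_gens c by metis
  then show ?case using g z IH by (simp add: p del: replicate_Suc)
qed

text \<open>The height gives the common number of bricks, greediness gives the first brick, and
  cancelling it leaves the tails.\<close>

lemma brick_family_unique:
  assumes "brick_family n ps" "brick_family n qs"
    "act_word n (brick_word n ps) origin = act_word n (brick_word n qs) origin"
  shows "ps = qs"
proof -
  have "int (length ps) = int (length qs)"
    using brick_family_greedy[OF assms(1)] brick_family_greedy[OF assms(2)] assms(3) by metis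
  then have "length ps = length qs" by simp
  then show ?thesis using assms
  proof (induction ps qs rule: list_induct2)
    case Nil
    then show ?case by simp
  next
    case (Cons p ps q qs)
    have eq: "q = p"
      using brick_family_greedy[OF Cons.prems(1)] brick_family_greedy[OF Cons.prems(2)]
        greedy_unique Cons.prems(3) by (metis list.distinct(1) list.sel(1) prod.expand)
    obtain j i where p: "p = (j, i)" by (cases p)
    have c: "1 \<le> j" "j \<le> n + 1" "i \<le> n - 1" "ps = [] \<or> brick_family n ps"
        "qs = [] \<or> brick_family n qs"
      using Cons.prems(1,2) unfolding eq p brick_family_Cons by auto
    have "act_word n (brick_word n ps) origin = act_word n (brick_word n qs) origin"
    proof (rule act_word_inj)
      show "brick n j i \<in> lists (gens n)" using brick_in_gens c by blast
    qed (use Cons.prems(3) in \<open>simp_all add: eq p del: replicate_Suc\<close>)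
    then have "ps = qs" using Cons.IH Cons.hyps c(4,5) by (cases "ps = []") auto
    then show ?case using eq by simp
  qed
qed

text \<open>Removing the greedy brick lowers the height by one until the origin is reached;
  \<open>link_of_greedy\<close> shows that the removed bricks fit together.\<close>

lemma brick_family_exists:
  assumes "vec x" "sum_list x = 0"
  shows "\<exists>ps. brick_family n ps \<and> act_word n (brick_word n ps) origin = x"
  using assms
proof (induction "nat (height x)" arbitrary: x rule: less_induct)
  case less
  show ?case
  proof (cases "\<exists>a\<in>set x. a \<noteq> 0")
    case False
    then have "x = origin" using less.prems(1) by (metis replicate_eqI)
    then have "act_word n (brick_word n []) origin = x" by simp
    moreover have "brick_family n []" by (simp add: brick_family_def cond_a_def cond_b_def cond_c_def)
    ultimately show ?thesis by blast
  next
    case True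
    then obtain j i where g: "greedy x j i" using greedy_exists less.prems by blast
    from greedy_brick_cover[OF less.prems(1) this] obtain y where y: "vec y"
      "act_word n (brick n j i) y = x" "height x = height y + 1" "sum_list y = sum_list x"
      "1 \<le> j" "j \<le> n + 1" "i \<le> n - 1" by metis
    have "0 \<le> height y" unfolding height_def by (rule sum_list_nonneg) auto
    then obtain ps where ps: "brick_family n ps" "act_word n (brick_word n ps) origin = y"
      using less.hyps[of y] y less.prems by auto
    have "ps = [] \<or> link n (j, i) (hd ps)"
    proof (cases "ps = []")
      case False
      then have "greedy y (fst (hd ps)) (snd (hd ps))" using brick_family_greedy[OF ps(1)] ps(2) by simp
      then show ?thesis using link_of_greedy[OF y(1,5-7)] g y(2) by (metis prod.collapse)
    qed simp
    then have "brick_family n ((j, i) # ps)" using ps(1) y by (simp add: brick_family_Cons)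
    moreover have "act_word n (brick_word n ((j, i) # ps)) origin = x" using ps y by (simp del: replicate_Suc)
    ultimately show ?thesis by blast
  qed
qed

end

section \<open>Reduced words and cosets\<close>

context affine_rank
begin

text \<open>Words that attain the bound of \<open>depth_le_length\<close>. They turn out to be the
  reduced words of distinguished representatives only: \<open>[Sig i]\<close> is not among them, as
  it fixes the origin.\<close>

definition reduced :: "gen list \<Rightarrow> bool" where
  "reduced u \<longleftrightarrow> u \<in> lists (gens n) \<and> int (length u) = depth (act_word n u origin)"

lemma brick_word_reduced: "brick_family n ps \<Longrightarrow> reduced (brick_word n ps)"
  using brick_family_greedy brick_word_in_gens by (simp add: reduced_def del: replicate_Suc)

lemma reduced_exists: "vec x \<Longrightarrow> sum_list x = 0 \<Longrightarrow> \<exists>u. reduced u \<and> act_word n u origin = x"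
  using brick_family_exists brick_word_reduced by blast

lemma reduced_gens: "reduced u \<Longrightarrow> u \<in> lists (gens n)"
  by (simp add: reduced_def)

lemma reduced_Nil: "reduced []"
  using depth_origin by (simp add: reduced_def)

text \<open>A letter raises the depth by at most one, so attaining the total forces the tail to
  attain its own bound and the first letter to be a strict ascent.\<close>

lemma reduced_ConsD:
  assumes "reduced (s # u)"
  shows "s \<in> gens n" "reduced u" "0 < gap n s (act_word n (s # u) origin)"
proof -
  let ?y = "act_word n u origin"
  have su: "s \<in> gens n" "u \<in> lists (gens n)" using assms by (auto simp: reduced_def)
  have y: "vec ?y" by simp
  have "depth ?y - sgn (gap n s ?y) = int (length u) + 1"
    using assms depth_act[OF y su(1)] by (simp add: reduced_def)
  then have "depth ?y = int (length u)" "gap n s ?y < 0"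
    using depth_le_length[OF su(2)] by (auto simp: sgn_if split: if_splits)
  then show "s \<in> gens n" "reduced u" "0 < gap n s (act_word n (s # u) origin)"
    using su gap_act_self[OF y su(1)] by (simp_all add: reduced_def del: replicate_Suc)
qed

lemma reduced_ConsI:
  assumes "reduced u" "s \<in> gens n" "gap n s (act_word n u origin) < 0"
  shows "reduced (s # u)"
  using assms depth_act[of "act_word n u origin" s] by (auto simp: reduced_def simp del: replicate_Suc)

lemma descent_cover:
  assumes "vec x" "sum_list x = 0" "s \<in> gens n" "0 < gap n s x"
  obtains w where "reduced w" "act_word n w origin = act n s x" "reduced (s # w)"
    "act_word n (s # w) origin = x"
proof -
  obtain w where w: "reduced w" "act_word n w origin = act n s x"
    using reduced_exists[of "act n s x"] assms sum_list_act by auto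
  moreover have "reduced (s # w)"
    using reduced_ConsI[OF w(1) assms(3)] w(2) gap_act_self assms by simp
  moreover have "act_word n (s # w) origin = x" using w(2) act_act assms by simp
  ultimately show thesis using that by blast
qed

lemma sum_list_orbit: "u \<in> lists (gens n) \<Longrightarrow> sum_list (act_word n u origin) = 0"
  using sum_list_act_word[of origin u] by (simp add: sum_list_replicate del: replicate_Suc)

text \<open>As in the proof of Matsumoto's theorem, two distinct first letters are both descents of the common
  point, which therefore has a reduced word that starts with the longest element of the dihedral
  subgroup they generate.\<close>

lemma reduced_cong:
  assumes "reduced u" "reduced v" "act_word n u origin = act_word n v origin"
  shows "u \<sim>\<^sub>C v"
  using assms
proof (induction "length u" arbitrary: u v rule: less_induct)
  case less
  let ?x = "act_word n u origin"
  have len: "length u = length v" using less.prems by (simp add: reduced_def)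
  show ?case
  proof (cases u)
    case Nil
    then show ?thesis using len by (simp add: cox_eq.refl)
  next
    case (Cons s u')
    then obtain t v' where v: "v = t # v'" using len by (cases v) auto
    note s = reduced_ConsD[OF less.prems(1)[unfolded Cons]]
    note t = reduced_ConsD[OF less.prems(2)[unfolded v]]
    have lists: "u' \<in> lists (gens n)" "v' \<in> lists (gens n)" using s(2) t(2) reduced_gens by auto
    have x: "vec ?x" "sum_list ?x = 0"
      using sum_list_orbit less.prems(1) reduced_gens by simp_all
    have gs: "0 < gap n s ?x" using s(3) Cons by simp
    have gt: "0 < gap n t ?x" using t(3) v less.prems(3) by simp
    have u': "act_word n u' origin = act n s ?x"
      using act_act[of "act_word n u' origin" s] s(1) Cons by simp
    have v': "act_word n v' origin = act n t ?x"
      using act_act[of "act_word n v' origin" t] t(1) v less.prems(3) by simp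
    have IHu: "u' \<sim>\<^sub>C w" if "reduced w" "act_word n w origin = act n s ?x" for w
      using less.hyps[of u' w] s(2) that u' Cons by simp
    have IHv: "v' \<sim>\<^sub>C w" if "reduced w" "act_word n w origin = act n t ?x" for w
      using less.hyps[of v' w] t(2) that v' len Cons v by simp
    consider "s = t" | "s \<noteq> t" "\<not> adjacent n s t" | "s \<noteq> t" "adjacent n s t" by blast
    then show ?thesis
    proof cases
      case 1
      then have "u' \<sim>\<^sub>C v'" using IHu t(2) v' by simp
      then show ?thesis using cong_Cons s(1) 1 Cons v by simp
    next
      case 2
      have "0 < gap n t (act n s ?x)" using gap_act[OF x(1) s(1) t(1) 2(1)] 2(2) gt by simp
      then obtain w where w: "reduced w" "act_word n w origin = act n t (act n s ?x)" "reduced (t # w)"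
        "act_word n (t # w) origin = act n s ?x"
        using descent_cover[of "act n s ?x" t] x s(1) t(1) sum_list_act by auto
      have "0 < gap n s (act n t ?x)"
        using gap_act[OF x(1) t(1) s(1)] 2 gs adjacent_sym[of n s t] by simp
      then have sw: "reduced (s # w)" "act_word n (s # w) origin = act n t ?x"
        using reduced_ConsI[OF w(1) s(1)] w(2) gap_act_self[of "act n t ?x" s] s(1) t(1) x(1)
          act_commute[OF x(1) s(1) t(1) 2] act_act[of "act n t ?x" s] by auto
      have wl: "w \<in> lists (gens n)" using w(1) reduced_gens by blast
      have "s # u' \<sim>\<^sub>C s # t # w" using IHu[OF w(3,4)] cong_Cons s(1) by blast
      moreover have "s # t # w \<sim>\<^sub>C t # s # w" using cong_commute[OF wl s(1) t(1) 2] .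
      moreover have "t # v' \<sim>\<^sub>C t # s # w" using IHv[OF sw] cong_Cons t(1) by blast
      ultimately show ?thesis unfolding Cons v by (meson cox_eq.sym cox_eq.trans)
    next
      case 3
      have ne3: "t \<noteq> s" "adjacent n t s" using 3 adjacent_sym[of n s t] by auto
      \<comment> \<open>Both roots are positive at \<open>?x\<close>, and their sum is the third
        positive root of the dihedral subgroup, so \<open>a\<close>, \<open>b\<close>,
        \<open>a\<close> descend in turn. Stated for generic letters, this serves both starting
        letters.\<close>
      have ex: "\<exists>w. reduced w \<and> act_word n w origin = act n a (act n b (act n a ?x)) \<and>
          reduced (b # a # w) \<and> act_word n (b # a # w) origin = act n a ?x"
        if ab: "a \<in> gens n" "b \<in> gens n" "a \<noteq> b" "adjacent n a b" "0 < gap n a ?x" "0 < gap n b ?x"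
        for a b
      proof -
        have ba: "adjacent n b a" using ab(4) adjacent_sym[of n a b] by simp
        let ?y = "act n a ?x"
        let ?z = "act n b ?y"
        have y: "vec ?y" "sum_list ?y = 0" "vec ?z" "sum_list ?z = 0" 
          using x ab sum_list_act by simp_all
        have gb: "gap n b ?y = gap n b ?x + gap n a ?x" using gap_act[OF x(1) ab(1,2,3)] ab(4) by simp
        have ga: "gap n a ?z = gap n b ?x"
          using gap_act[OF y(1) ab(2,1)] ab(3) ba gb gap_act_self[OF x(1) ab(1)] by simp
        obtain w where w: "reduced w" "act_word n w origin = act n a ?z" "reduced (a # w)"
          "act_word n (a # w) origin = ?z"
          using descent_cover[OF y(3,4) ab(1)] ga ab(6) by auto
        have "gap n b ?z < 0" using gap_act_self[OF y(1) ab(2)] gb ab(5,6) by simp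
        then have "reduced (b # a # w)" using reduced_ConsI[OF w(3) ab(2)] w(4) by simp
        moreover have "act_word n (b # a # w) origin = ?y" using w(4) act_act[OF y(1) ab(2)] by simp
        ultimately show ?thesis using w by blast
      qed
      obtain w where w: "reduced w" "act_word n w origin = act n s (act n t (act n s ?x))"
        "reduced (t # s # w)" "act_word n (t # s # w) origin = act n s ?x"
        using ex[OF s(1) t(1) 3 gs gt] by blast
      obtain w' where w': "reduced w'" "act_word n w' origin = act n t (act n s (act n t ?x))"
        "reduced (s # t # w')" "act_word n (s # t # w') origin = act n t ?x"
        using ex[OF t(1) s(1) ne3 gt gs] by blast
      have wl: "w \<in> lists (gens n)" using w(1) reduced_gens by blast
      have eq: "act_word n w origin = act_word n w' origin"
        using w(2) w'(2) act_braid[OF x(1) s(1) t(1) 3] by simp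
      \<comment> \<open>Equal points have equal depth, so \<open>w\<close> is two letters shorter
        than \<open>u'\<close> and the induction hypothesis applies to it.\<close>
      have "length (t # s # w) = length u'"
        using w(3,4) s(2) u' by (simp add: reduced_def del: replicate_Suc act_word_Cons)
      then have "w \<sim>\<^sub>C w'" using less.hyps[of w w'] w(1) w'(1) eq Cons by simp
      then have "t # s # t # w \<sim>\<^sub>C t # s # t # w'" using cong_Cons s(1) t(1) by blast
      moreover have "s # u' \<sim>\<^sub>C s # t # s # w" using IHu[OF w(3,4)] cong_Cons s(1) by blast
      moreover have "s # t # s # w \<sim>\<^sub>C t # s # t # w" using cong_braid[OF wl s(1) t(1) 3(2)] .
      moreover have "t # v' \<sim>\<^sub>C t # s # t # w'" using IHv[OF w'(3,4)] cong_Cons t(1) by blast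
      ultimately show ?thesis unfolding Cons v by (meson cox_eq.sym cox_eq.trans)
    qed
  qed
qed

section \<open>Factorisation of words along W(A_n)\<close>

abbreviation fin_gens :: "gen set" where
  "fin_gens \<equiv> Sig ` {1..n}"

lemma fin_gens_subset: "fin_gens \<subseteq> gens n"
  by (auto simp: gens_def)

lemma gap_fin_origin: "s \<in> gens n \<Longrightarrow> gap n s origin = 0 \<longleftrightarrow> s \<in> fin_gens"
  by (cases s) (auto simp: gens_def nth_Cons')

text \<open>The case of Deodhar's lemma in which \<open>s\<close> fixes the coset of
  \<open>u\<close>. The reflection is pushed past the first letter \<open>t\<close> of
  \<open>u\<close>, by commutation or, once \<open>u\<close> is rewritten to begin with
  \<open>t\<close> and \<open>s\<close>, by the braid relation. At the empty word it fixes the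
  origin and is thus a finite generator.\<close>

lemma cong_conjugate:
  assumes "s \<in> gens n" "reduced u" "gap n s (act_word n u origin) = 0"
  shows "\<exists>t\<in>fin_gens. s # u \<sim>\<^sub>C u @ [t]"
  using assms
proof (induction "length u" arbitrary: s u rule: less_induct)
  case less
  let ?x = "act_word n u origin"
  show ?case
  proof (cases u)
    case Nil
    then have "s \<in> fin_gens" using less.prems gap_fin_origin by simp
    moreover have "s # u \<sim>\<^sub>C u @ [s]" using Nil less.prems(1) by (auto intro: cox_eq.refl)
    ultimately show ?thesis by blast
  next
    case (Cons t u')
    note s = less.prems(1)
    note t = reduced_ConsD[OF less.prems(2)[unfolded Cons]]
    have x: "vec ?x" "sum_list ?x = 0"
      using sum_list_orbit less.prems(2) reduced_gens by simp_all
    have gs: "gap n s ?x = 0" and gt: "0 < gap n t ?x" using less.prems(3) t(3) Cons by simp_all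
    have u': "act_word n u' origin = act n t ?x"
      using act_act[of "act_word n u' origin" t] t(1) Cons by simp
    have ul: "u' \<in> lists (gens n)" using t(2) reduced_gens by blast
    have ne: "t \<noteq> s" using gs gt by auto
    show ?thesis
    proof (cases "adjacent n t s")
      case False
      then have "gap n s (act n t ?x) = 0" using gap_act[OF x(1) t(1) s ne] gs by simp
      then obtain r where r: "r \<in> fin_gens" "s # u' \<sim>\<^sub>C u' @ [r]"
        using less.hyps[of u' s] s t(2) u' Cons by auto
      have "s # t # u' \<sim>\<^sub>C t # s # u'"
        using cong_commute[OF ul s t(1)] ne False adjacent_sym[of n s t] by auto
      moreover have "t # s # u' \<sim>\<^sub>C t # u' @ [r]" using cong_Cons[OF r(2) t(1)] .
      ultimately have "s # u \<sim>\<^sub>C u @ [r]" unfolding Cons by (auto intro: cox_eq.trans)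
      then show ?thesis using r(1) by blast
    next
      case True
      let ?y = "act n t ?x"
      have y: "vec ?y" "sum_list ?y = 0" using x t(1) sum_list_act by simp_all
      have ga: "gap n s ?y = gap n t ?x" using gap_act[OF x(1) t(1) s ne] True gs by simp
      obtain w where w: "reduced w" "act_word n w origin = act n s ?y" "reduced (s # w)"
          "act_word n (s # w) origin = ?y"
        using descent_cover[OF y s] ga gt by auto
      have wl: "w \<in> lists (gens n)" using w(1) reduced_gens by blast
      have usw: "u' \<sim>\<^sub>C s # w" using reduced_cong[OF t(2) w(3)] u' w(4) by simp
      \<comment> \<open>The summands are \<open>- gap n t ?x\<close> and \<open>gap n t ?x\<close>.
        So \<open>t\<close> takes over the role of \<open>s\<close> for the shorter word
        \<open>w\<close>.\<close>
      have "gap n t (act n s ?y) = 0"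
        using gap_act[OF y(1) s t(1)] ne True adjacent_sym[of n s t] ga gap_act_self[OF x(1) t(1)]
        by auto
      moreover have "length w < length u"
        using w(3,4) t(2) u' Cons by (simp add: reduced_def del: replicate_Suc act_word_Cons)
      ultimately obtain r where r: "r \<in> fin_gens" "t # w \<sim>\<^sub>C w @ [r]"
        using less.hyps[of w t] t(1) w(1,2) by auto
      have rl: "[r] \<in> lists (gens n)" using r(1) fin_gens_subset by auto
      have "s # t # u' \<sim>\<^sub>C s # t # s # w" using usw cong_Cons s t(1) by blast
      moreover have "s # t # s # w \<sim>\<^sub>C t # s # t # w"
        using cong_braid[OF wl s t(1)] True adjacent_sym[of n s t] by simp
      moreover have "t # s # t # w \<sim>\<^sub>C t # s # w @ [r]" using r(2) cong_Cons s t(1) by blast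
      moreover have "t # (s # w) @ [r] \<sim>\<^sub>C t # u' @ [r]"
        using cong_Cons[OF cox_eq_append_right[OF cox_eq.sym[OF usw] rl] t(1)] .
      ultimately have "s # u \<sim>\<^sub>C u @ [r]" unfolding Cons by (auto intro: cox_eq.trans)
      then show ?thesis using r(1) by blast
    qed
  qed
qed

text \<open>A new first letter prolongs the reduced part, passes through it into the finite part, or
  cancels against it, according to the sign of \<open>gap\<close>.\<close>

lemma reduced_decomposition:
  assumes "u \<in> lists (gens n)"
  shows "\<exists>v f. reduced v \<and> f \<in> lists fin_gens \<and> u \<sim>\<^sub>C v @ f"
  using assms
proof (induction u)
  case Nil
  then show ?case using reduced_Nil by (metis append_Nil cox_eq.refl lists.Nil)
next
  case (Cons s u)
  then obtain v f where vf: "reduced v" "f \<in> lists fin_gens" "u \<sim>\<^sub>C v @ f" by auto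
  have s: "s \<in> gens n" using Cons by auto
  have fl: "f \<in> lists (gens n)" using vf(2) lists_mono[OF fin_gens_subset] by blast
  let ?x = "act_word n v origin"
  have x: "vec ?x" "sum_list ?x = 0"
    using sum_list_orbit vf(1) reduced_gens by simp_all
  have sv: "s # u \<sim>\<^sub>C s # v @ f" using cong_Cons[OF vf(3) s] .
  consider "gap n s ?x < 0" | "gap n s ?x = 0" | "0 < gap n s ?x" by linarith
  then show ?case
  proof cases
    case 1
    then have "reduced (s # v)" using reduced_ConsI vf(1) s by blast
    then show ?thesis using sv vf(2) by (metis append_Cons)
  next
    case 2
    then obtain r where r: "r \<in> fin_gens" "s # v \<sim>\<^sub>C v @ [r]" using cong_conjugate s vf(1) by blast
    have "s # v @ f \<sim>\<^sub>C v @ r # f" using cox_eq_append_right[OF r(2) fl] by simp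
    moreover have "r # f \<in> lists fin_gens" using r vf(2) by simp
    ultimately show ?thesis using sv vf(1) cox_eq.trans by blast
  next
    case 3
    then obtain w where w: "reduced w" "reduced (s # w)" "act_word n (s # w) origin = ?x"
      using descent_cover[OF x s] by metis
    then have "v \<sim>\<^sub>C s # w" using reduced_cong vf(1) by simp
    then have "s # v @ f \<sim>\<^sub>C s # (s # w) @ f" using cong_Cons[OF cox_eq_append_right[OF _ fl] s] by blast
    moreover have "s # (s # w) @ f \<sim>\<^sub>C w @ f"
      using cong_cancel[of "[]" "w @ f" s] w(1) reduced_gens fl s by simp
    ultimately show ?thesis using sv w(1) vf(2) cox_eq.trans by blast
  qed
qed

section \<open>Coxeter length and cosets in the group\<close>

abbreviation wcls :: "gen list \<Rightarrow> gen list set" where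
  "wcls \<equiv> word_class (gens n) (cox_matrix n)"

lemma expression_cong: "expression n u w \<Longrightarrow> expression n v w \<longleftrightarrow> u \<sim>\<^sub>C v"
  unfolding expression_def using word_class_eq_iff cox_eq_lists by (metis (no_types, lifting))

lemma mult_W_aff:
  "u \<in> lists (gens n) \<Longrightarrow> v \<in> lists (gens n) \<Longrightarrow> wcls u \<otimes>\<^bsub>W_aff n\<^esub> wcls v = wcls (u @ v)"
  unfolding W_aff_def by (rule word_class_mult)

lemma carrier_W_aff: "carrier (W_aff n) = wcls ` lists (gens n)"
  and one_W_aff: "\<one>\<^bsub>W_aff n\<^esub> = wcls []"
  by (simp_all add: W_aff_def coxeter_group_def)

text \<open>The generators are involutions, so inverses add nothing to the positive words in
  them.\<close>

lemma W_fin_eq: "W_fin n = wcls ` lists fin_gens"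
proof
  interpret G: group "W_aff n" by (rule group_W_aff)
  have inv_Sig: "inv\<^bsub>W_aff n\<^esub> wcls [Sig i] = wcls [Sig i]" if "i \<in> {1..n}" for i
  proof (rule G.inv_equality)
    have s: "Sig i \<in> gens n" using that by (simp add: gens_def)
    then show "wcls [Sig i] \<in> carrier (W_aff n)" "wcls [Sig i] \<in> carrier (W_aff n)"
      by (auto simp: carrier_W_aff)
    show "wcls [Sig i] \<otimes>\<^bsub>W_aff n\<^esub> wcls [Sig i] = \<one>\<^bsub>W_aff n\<^esub>"
      using s cong_cancel[of "[]" "[]" "Sig i"] by (simp add: mult_W_aff one_W_aff word_class_eq_iff)
  qed
  show "W_fin n \<subseteq> wcls ` lists fin_gens"
  proof
    fix w assume "w \<in> W_fin n"
    then show "w \<in> wcls ` lists fin_gens"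
      unfolding W_fin_def
    proof (induction rule: generate.induct)
      case one
      then show ?case by (auto simp: one_W_aff)
    next
      case (incl h)
      then show ?case by auto
    next
      case (inv h)
      then show ?case using inv_Sig by auto
    next
      case (eng g h)
      then obtain a b where ab: "a \<in> lists fin_gens" "b \<in> lists fin_gens" "g = wcls a" "h = wcls b" by auto
      then have "g \<otimes>\<^bsub>W_aff n\<^esub> h = wcls (a @ b)"
        using mult_W_aff lists_mono[OF fin_gens_subset] by blast
      then show ?case using ab by auto
    qed
  qed
  show "wcls ` lists fin_gens \<subseteq> W_fin n"
  proof
    fix w assume "w \<in> wcls ` lists fin_gens"
    then obtain f where "f \<in> lists fin_gens" "w = wcls f" by blast
    then show "w \<in> W_fin n"
    proof (induction f arbitrary: w)
      case Nil
      then show ?case by (simp add: W_fin_def generate.one flip: one_W_aff)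
    next
      case (Cons s f)
      then have "s \<in> gens n" "f \<in> lists (gens n)" using fin_gens_subset by auto
      then have "w = wcls [s] \<otimes>\<^bsub>W_aff n\<^esub> wcls f" using Cons.prems by (simp add: mult_W_aff)
      moreover have "wcls f \<in> W_fin n" using Cons by auto
      moreover have "wcls [s] \<in> W_fin n" using Cons.hyps by (auto simp: W_fin_def intro: generate.incl)
      ultimately show ?case unfolding W_fin_def by (simp add: generate.eng)
    qed
  qed
qed

lemma act_word_fin: "f \<in> lists fin_gens \<Longrightarrow> act_word n f origin = origin"
proof (induction f)
  case (Cons s f)
  then have "s \<in> gens n" "s \<in> fin_gens" using fin_gens_subset by auto
  then show ?case using Cons act_fixed_iff[of origin s] gap_fin_origin by (simp del: replicate_Suc)
qed simp

lemma expression_carrier: "expression n u w \<Longrightarrow> w \<in> carrier (W_aff n)"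
  unfolding carrier_W_aff expression_def by blast

lemma expression_point:
  "expression n u w \<Longrightarrow> expression n v w \<Longrightarrow> act_word n u origin = act_word n v origin"
  using expression_cong[of u w v] act_word_cong[of u v origin] by simp

lemma cox_length_attained:
  assumes "w \<in> carrier (W_aff n)"
  obtains u where "expression n u w" "length u = cox_length n w"
proof -
  have "\<exists>k u. expression n u w \<and> length u = k"
    using assms by (auto simp: carrier_W_aff expression_def)
  from LeastI_ex[OF this] show thesis using that unfolding cox_length_def by blast
qed

lemma cox_length_le: "expression n u w \<Longrightarrow> cox_length n w \<le> length u"
  unfolding cox_length_def by (rule Least_le) blast

lemma depth_le_cox_length:
  assumes "expression n u w"
  shows "depth (act_word n u origin) \<le> int (cox_length n w)"
proof -
  have "w \<in> carrier (W_aff n)" using assms expression_carrier by blast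
  then obtain v where "expression n v w" "length v = cox_length n w" using cox_length_attained by blast
  then show ?thesis using depth_le_length[of v] expression_point[OF assms] by (simp add: expression_def)
qed

lemma cox_length_reduced:
  assumes "reduced u" "expression n u w"
  shows "cox_length n w = length u"
  using depth_le_cox_length[OF assms(2)] cox_length_le[OF assms(2)] assms(1) by (simp add: reduced_def)

lemma coset_expression:
  assumes "expression n u w" "v \<in> w <#\<^bsub>W_aff n\<^esub> W_fin n"
  obtains f where "f \<in> lists fin_gens" "expression n (u @ f) v"
proof -
  obtain f where "f \<in> lists fin_gens" "v = w \<otimes>\<^bsub>W_aff n\<^esub> wcls f"
    using assms(2) by (auto simp: l_coset_def W_fin_eq)
  moreover from this have "f \<in> lists (gens n)" using lists_mono[OF fin_gens_subset] by blast
  ultimately show thesis using that assms(1) mult_W_aff by (auto simp: expression_def)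
qed

text \<open>Elements of one coset move the origin to the same point, whose depth bounds all their
  lengths from below. A reduced word attains this bound, and \<open>reduced_cong\<close> makes the
  attaining element unique.\<close>

lemma distinguished_rep_iff: "distinguished_rep n w \<longleftrightarrow> (\<exists>u. reduced u \<and> expression n u w)"
proof
  assume w: "distinguished_rep n w"
  then obtain u where u: "expression n u w" by (auto simp: distinguished_rep_def carrier_W_aff expression_def)
  then obtain v f where vf: "reduced v" "f \<in> lists fin_gens" "u \<sim>\<^sub>C v @ f"
    using reduced_decomposition unfolding expression_def by blast
  have fl: "f \<in> lists (gens n)" and rl: "rev f \<in> lists (gens n)" and rf: "rev f \<in> lists fin_gens"
    using vf(2) lists_mono[OF fin_gens_subset] by auto
  have vl: "v \<in> lists (gens n)" using vf(1) reduced_gens by blast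
  have "f @ rev f \<sim>\<^sub>C []"
    using cox_eq_rev[of "gens n" "cox_matrix n" "rev f"] rl by (simp add: cox_matrix_def)
  from cox_eq_append_left[OF this vl] have "v @ f @ rev f \<sim>\<^sub>C v" by simp
  with cox_eq_append_right[OF vf(3) rl] have "u @ rev f \<sim>\<^sub>C v" by (auto intro: cox_eq.trans)
  then have v: "wcls v = wcls (u @ rev f)" using u rl
    by (subst word_class_eq_iff) (auto intro: cox_eq.sym simp: vl)
  \<comment> \<open>Right multiplication by \<open>rev f\<close>, the inverse of the finite part,
    stays in the coset.\<close>
  have "wcls v \<in> w <#\<^bsub>W_aff n\<^esub> W_fin n"
    using u rl rf mult_W_aff[of u "rev f"] by (auto simp: v l_coset_def W_fin_eq expression_def)
  moreover have "cox_length n (wcls v) \<le> cox_length n w"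
  proof -
    have "expression n v (wcls v)" using vl by (simp add: expression_def)
    then have "int (cox_length n (wcls v)) = depth (act_word n v origin)"
      using cox_length_reduced[OF vf(1)] vf(1) by (simp add: reduced_def)
    also have "\<dots> = depth (act_word n (v @ f) origin)" using act_word_fin[OF vf(2)] by (simp del: replicate_Suc)
    also have "\<dots> \<le> int (cox_length n w)"
      using depth_le_cox_length[OF u] act_word_cong[OF vf(3), of origin] by (simp del: replicate_Suc)
    finally show ?thesis by simp
  qed
  ultimately have "wcls v = w" using w unfolding distinguished_rep_def by (metis leD)
  then show "\<exists>u. reduced u \<and> expression n u w" using vf(1) vl by (auto simp: expression_def)
next
  assume "\<exists>u. reduced u \<and> expression n u w"
  then obtain u where u: "reduced u" "expression n u w" by blast
  show "distinguished_rep n w"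
    unfolding distinguished_rep_def
  proof (intro conjI ballI impI)
    show "w \<in> carrier (W_aff n)" using u expression_carrier by blast
    fix v assume v: "v \<in> w <#\<^bsub>W_aff n\<^esub> W_fin n" "v \<noteq> w"
    obtain f where f: "f \<in> lists fin_gens" "expression n (u @ f) v" using coset_expression[OF u(2) v(1)] .
    then have "v \<in> carrier (W_aff n)" using expression_carrier by blast
    then obtain v' where v': "expression n v' v" "length v' = cox_length n v"
      using cox_length_attained by blast
    have pt: "act_word n v' origin = act_word n u origin"
      using expression_point[OF v'(1) f(2)] act_word_fin[OF f(1)] by (simp del: replicate_Suc)
    show "cox_length n w < cox_length n v"
    proof (rule ccontr)
      assume "\<not> ?thesis"
      then have "length v' \<le> length u" using v'(2) cox_length_reduced[OF u] by simp
      \<comment> \<open>\<open>v'\<close> reaches the same point as \<open>u\<close> and is no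
        longer, so it attains the depth bound as well.\<close>
      then have "reduced v'"
        using depth_le_length[of v'] v'(1) pt u(1) by (simp add: reduced_def expression_def)
      then have "u \<sim>\<^sub>C v'" using reduced_cong u(1) pt by simp
      then have "v = w" using expression_cong[OF u(2)] v'(1) by (auto simp: expression_def)
      then show False using v(2) by blast
    qed
  qed
qed

section \<open>Brick words as reduced expressions\<close>

lemma count_list_brick: "count_list (brick n j i) Aff = 1"
proof -
  have "count_list (map Sig ks) Aff = 0" for ks by (induction ks) auto
  then show ?thesis by (simp add: brick_def h_word_def up_word_def down_word_def)
qed

text \<open>Each brick contains one \<open>Aff\<close>, while \<open>height\<close>, equal to the
  number of bricks, bounds the occurrences in any expression from below.\<close>

lemma affine_length_brick_word:
  assumes "brick_family n ps" "expression n (brick_word n ps) w"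
  shows "affine_length n w = length ps"
  unfolding affine_length_def
proof (rule Least_equality)
  have "count_list (brick_word n ps) Aff = length ps"
    by (induction ps) (simp_all add: count_list_brick)
  then show "\<exists>u. expression n u w \<and> count_list u Aff = length ps" using assms(2) by blast
  fix k assume "\<exists>u. expression n u w \<and> count_list u Aff = k"
  then obtain u where u: "expression n u w" "count_list u Aff = k" by blast
  then have "height (act_word n u origin) \<le> int k"
    using height_le_count[of u] by (simp add: expression_def)
  then show "length ps \<le> k"
    using brick_family_greedy[OF assms(1)] expression_point[OF u(1) assms(2)] by simp
qed

lemma brick_word_reduced_expression:
  assumes "brick_family n ps" "expression n (brick_word n ps) w"
  shows "reduced_expression n (brick_word n ps) w"
  using cox_length_reduced[OF brick_word_reduced] assms by (simp add: reduced_expression_def)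

text \<open>The only candidate is the family of the point to which \<open>w\<close> moves the
  origin. Its word represents \<open>w\<close> because it and a reduced word of \<open>w\<close>
  reach the same point and are both reduced.\<close>

lemma distinguished_rep_brick_word:
  assumes "distinguished_rep n w"
  shows "\<exists>!ps. length ps = affine_length n w \<and> brick_family n ps \<and>
    reduced_expression n (brick_word n ps) w"
proof -
  obtain u where u: "reduced u" "expression n u w" using assms distinguished_rep_iff by blast
  have "vec (act_word n u origin)" "sum_list (act_word n u origin) = 0"
    using sum_list_orbit reduced_gens u(1) by simp_all
  then obtain ps where ps: "brick_family n ps" "act_word n (brick_word n ps) origin = act_word n u origin"
    using brick_family_exists by blast
  then have "u \<sim>\<^sub>C brick_word n ps" using reduced_cong[OF u(1) brick_word_reduced] by simp
  then have e: "expression n (brick_word n ps) w" using expression_cong[OF u(2)] by simp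
  show ?thesis
  proof (rule ex1I[of _ ps])
    show "length ps = affine_length n w \<and> brick_family n ps \<and> reduced_expression n (brick_word n ps) w"
      using affine_length_brick_word brick_word_reduced_expression ps(1) e by simp
    fix qs
    assume "length qs = affine_length n w \<and> brick_family n qs \<and> reduced_expression n (brick_word n qs) w"
    then have "brick_family n qs" "expression n (brick_word n qs) w" by (simp_all add: reduced_expression_def)
    then show "qs = ps" using brick_family_unique ps(1) expression_point[OF _ e] by blast
  qed
qed

lemma brick_word_distinguished_rep:
  assumes "brick_family n ps"
  shows "\<exists>w. distinguished_rep n w \<and> affine_length n w = length ps \<and>
    reduced_expression n (brick_word n ps) w"
proof -
  have e: "expression n (brick_word n ps) (wcls (brick_word n ps))"
    using brick_word_in_gens[OF assms] by (simp add: expression_def)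
  then show ?thesis
    using distinguished_rep_iff brick_word_reduced affine_length_brick_word
      brick_word_reduced_expression assms by blast
qed

end

theorem theorem1p1:
  fixes n :: nat
  assumes "n \<ge> 2"
  shows "(\<forall>w. distinguished_rep n w \<longrightarrow>
            (\<exists>!ps. length ps = affine_length n w \<and> brick_family n ps \<and>
                   reduced_expression n (brick_word n ps) w)) \<and>
         (\<forall>ps. brick_family n ps \<longrightarrow>
            (\<exists>w. distinguished_rep n w \<and> affine_length n w = length ps \<and>
                 reduced_expression n (brick_word n ps) w))"
proof -
  interpret affine_rank n using assms by unfold_locales
  show ?thesis using distinguished_rep_brick_word brick_word_distinguished_rep by blast
qed

end
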